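(* Let $p=p(n)\in(0,1)$ and let $K_{n,p}$ denote the number of edges in any unimodular triangulation $\Delta_{n,p}$ of the random symmetric edge polytope $P_{n,p}$. Then $$\mathbb{E}[K_{n,p}]=6\binom n4p^2(2-p^2)+6\binom n3p^2+2\binom n2(1-p)\Bigl(1-(1-p^2)^{n-2}\Bigr)+2\binom n2p .$$ As $n\to\infty$, this behaves like $\mathbb{E}[K_{n,p}]\simeq n^4p^2$.
   Context: For a finite simple graph $G=(V,E)$ (elements of $V$ are nodes, elements of $E\subseteq\binom V2$ are arcs), with $(\mathbf{e}_i)_{i\in V}$ the standard basis of $\mathbb{R}^V$, the symmetric edge polytope is $P_G:=\operatorname{conv}\{\pm(\mathbf{e}_i-\mathbf{e}_j):\{i,j\}\in E\}\subset\mathbb{R}^V$ (empty if $E=\emptyset$, in which case the number of edges of a triangulation is $0$). A (lattice) triangulation of a $d$-dimensional lattice polytope $P$ is a subdivision of $P$ into $d$-dimensional lattice simplices with union $P$, any two of which meet in a (possibly empty) common face. It is unimodular if every $d$-simplex in it has minimal possible volume among lattice simplices, equivalently is lattice equivalent (with respect to the lattice $\mathbb{Z}^V\cap\operatorname{aff}(P)$ in the case of $P=P_G$) to the standard simplex spanned by the origin and the standard unit vectors. The edges of a triangulation are the $1$-dimensional elements of the simplicial complex consisting of its simplices and all their faces. It is known that every $P_G$ has a unimodular triangulation, and that all unimodular triangulations of a given lattice polytope have the same number of edges, so $K_{n,p}$ is well defined. $G_{n,p}$ is the Erdős–Rényi random graph on node set $[n]=\{1,\dots,n\}$, each arc of the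 complete graph being retained independently with probability $p=p(n)\in(0,1)$, where $p$ may depend on $n$; $P_{n,p}:=P_{G_{n,p}}$. Asymptotic notation for sequences: $a_n\simeq b_n$ means $0<\liminf_{n\to\infty}|a_n/b_n|\le\limsup_{n\to\infty}|a_n/b_n|<\infty$.
   Formalization: The asymptotic claim is proved only when liminf n²p > 0; without this it is false (e.g. p = 1/(n+1)³, where the last term 2·C(n,2)·p dominates n⁴p²). The exact formula for the expectation is proved for all n and all p in (0,1). *)

theory Defs
  imports
    "HOL-Probability.Probability"
    "HOL-Analysis.Finite_Function_Topology"
begin

text \<open>
  The ambient spaces \<open>\<real>\<^sup>V\<close>, for finite \<open>V\<close>, are realised inside the single real vector space
  \<open>'v \<Rightarrow>\<^sub>0 real\<close> of finitely supported functions, as the vectors supported on \<open>V\<close>. This allows the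
  number of nodes to vary within one statement.
\<close>

abbreviation basis_vec :: "'v \<Rightarrow> ('v \<Rightarrow>\<^sub>0 real)" where
  "basis_vec i \<equiv> Poly_Mapping.single i 1"

definition int_lattice :: "'v set \<Rightarrow> ('v \<Rightarrow>\<^sub>0 real) set" where
  "int_lattice V = {x. Poly_Mapping.keys x \<subseteq> V \<and> (\<forall>i\<in>V. Poly_Mapping.lookup x i \<in> \<int>)}"

text \<open>
  The library's \<open>aff_dim\<close> is restricted to Euclidean spaces, which \<open>'v \<Rightarrow>\<^sub>0 real\<close> is not. The
  following is only used for subsets of finite-dimensional subspaces (\<^const>\<open>dim\<close> is \<open>0\<close> on
  infinite-dimensional ones).
\<close>

definition affine_dim :: "'a::real_vector set \<Rightarrow> int" where
  "affine_dim S = (if S = {} then -1 else int (dim {x - y | x y. x \<in> S \<and> y \<in> S}))"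

definition lattice_simplex :: "'a::real_vector set \<Rightarrow> int \<Rightarrow> 'a set \<Rightarrow> bool" where
  "lattice_simplex L d S \<longleftrightarrow>
     (\<exists>C. C \<subseteq> L \<and> finite C \<and> \<not> affine_dependent C \<and> int (card C) = d + 1 \<and> S = convex hull C)"

text \<open>\<open>L\<close> is the set of lattice points. The empty polytope is triangulated by the empty set.\<close>

definition lattice_triangulation :: "'a::real_vector set \<Rightarrow> 'a set \<Rightarrow> 'a set set \<Rightarrow> bool" where
  "lattice_triangulation L P T \<longleftrightarrow>
     finite T \<and>
     (\<forall>S\<in>T. lattice_simplex L (affine_dim P) S) \<and>
     \<Union>T = P \<and>
     (\<forall>S\<in>T. \<forall>S'\<in>T. S \<inter> S' face_of S \<and> S \<inter> S' face_of S')"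

text \<open>
  Equivalence under an affine isomorphism \<open>x \<mapsto> f x + c\<close> between the affine spans of the lattices
  that maps the lattice \<open>L\<close> onto the lattice \<open>L'\<close>. (A linear map on a subspace extends to the whole
  space, so it is no restriction that \<open>f\<close> is defined everywhere.)
\<close>

definition lattice_equivalent ::
  "'a::real_vector set \<Rightarrow> 'a set \<Rightarrow> 'b::real_vector set \<Rightarrow> 'b set \<Rightarrow> bool" where
  "lattice_equivalent L S L' S' \<longleftrightarrow>
     (\<exists>f c. linear f \<and>
        bij_betw (\<lambda>x. f x + c) (affine hull L) (affine hull L') \<and>
        (\<lambda>x. f x + c) ` L = L' \<and>
        (\<lambda>x. f x + c) ` S = S')"

definition standard_simplex :: "nat \<Rightarrow> (nat \<Rightarrow>\<^sub>0 real) set" where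
  "standard_simplex d = convex hull (insert 0 (basis_vec ` {1..d}))"

definition unimodular_triangulation :: "'a::real_vector set \<Rightarrow> 'a set \<Rightarrow> 'a set set \<Rightarrow> bool" where
  "unimodular_triangulation L P T \<longleftrightarrow>
     lattice_triangulation L P T \<and>
     (\<forall>S\<in>T. let d = nat (affine_dim P)
            in lattice_equivalent L S (int_lattice {1..d}) (standard_simplex d))"

definition triangulation_edges :: "'a::real_vector set set \<Rightarrow> 'a set set" where
  "triangulation_edges T = {F. (\<exists>S\<in>T. F face_of S) \<and> affine_dim F = 1}"

definition symmetric_edge_polytope :: "'v set set \<Rightarrow> ('v \<Rightarrow>\<^sub>0 real) set" where
  "symmetric_edge_polytope E =
     convex hull (\<Union>{{basis_vec i - basis_vec j, - (basis_vec i - basis_vec j)} | i j. {i, j} \<in> E})"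

definition sep_lattice :: "'v set \<Rightarrow> 'v set set \<Rightarrow> ('v \<Rightarrow>\<^sub>0 real) set" where
  "sep_lattice V E = int_lattice V \<inter> affine hull (symmetric_edge_polytope E)"

definition complete_arcs :: "nat \<Rightarrow> nat set set" where
  "complete_arcs n = {e. e \<subseteq> {1..n} \<and> card e = 2}"

text \<open>The random arc set of \<open>G\<^sub>n\<^sub>,\<^sub>p\<close> on the node set \<open>{1..n}\<close>.\<close>

definition erdos_renyi :: "nat \<Rightarrow> real \<Rightarrow> nat set set pmf" where
  "erdos_renyi n p =
     map_pmf (\<lambda>retained. {e \<in> complete_arcs n. retained e})
       (Pi_pmf (complete_arcs n) False (\<lambda>_. bernoulli_pmf p))"

definition same_order :: "(nat \<Rightarrow> real) \<Rightarrow> (nat \<Rightarrow> real) \<Rightarrow> bool" where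
  "same_order a b \<longleftrightarrow>
     0 < liminf (\<lambda>n. ereal \<bar>a n / b n\<bar>) \<and>
     liminf (\<lambda>n. ereal \<bar>a n / b n\<bar>) \<le> limsup (\<lambda>n. ereal \<bar>a n / b n\<bar>) \<and>
     limsup (\<lambda>n. ereal \<bar>a n / b n\<bar>) < \<infinity>"

text \<open>
  \<open>\<Delta> n E\<close> is the triangulation chosen for the polytope of the graph \<open>([n], E)\<close>.
\<close>

definition expected_edges ::
  "(nat \<Rightarrow> nat set set \<Rightarrow> (nat \<Rightarrow>\<^sub>0 real) set set) \<Rightarrow> (nat \<Rightarrow> real) \<Rightarrow> nat \<Rightarrow> real" where
  "expected_edges \<Delta> p n =
     measure_pmf.expectation (erdos_renyi n (p n)) (\<lambda>E. real (card (triangulation_edges (\<Delta> n E))))"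

end

theory Submission
  imports Defs
begin

text \<open>
  The midpoint of an edge \<open>[v, w]\<close> of a unimodular triangulation of \<open>P\<close> determines the lattice
  point \<open>v + w\<close> of \<open>2P\<close>. Since a lattice point of \<open>2S\<close>, for a unimodular simplex \<open>S\<close>, is a sum of two
  vertices of \<open>S\<close>, and since simplices meet in common faces, the edges correspond bijectively to the
  points \<open>v + w\<close> with \<open>v, w\<close> lattice points of \<open>P\<close> that are not of the form \<open>u + u\<close>.

  The lattice points of \<open>P\<^sub>G\<close> are \<open>0\<close> and the vectors \<open>e\<^sub>i - e\<^sub>j\<close> with \<open>ij\<close> an arc, so these sums are
  \<open>e\<^sub>i - e\<^sub>j\<close> (\<open>ij\<close> is an arc or \<open>i\<close>, \<open>j\<close> have a common neighbour), \<open>\<plusminus>(2e\<^sub>i - e\<^sub>j - e\<^sub>k)\<close> (\<open>ij\<close>, \<open>ik\<close> are arcs)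
  and \<open>e\<^sub>i + e\<^sub>j - e\<^sub>k - e\<^sub>l\<close> (\<open>ik\<close>, \<open>jl\<close> or \<open>il\<close>, \<open>jk\<close> are arcs). The expected number of each kind
  follows by inclusion-exclusion.
\<close>

subsection \<open>Faces of simplices\<close>

text \<open>Subtracting the two sums gives an affine relation on \<open>C\<close> with coefficient
  sum 1 + 1 - 1 - 1 = 0, so independence makes every coefficient vanish.\<close>

lemma affine_independent_sum_eqD:
  fixes C :: "'a::real_vector set"
  assumes C: "finite C" "\<not> affine_dependent C"
    and mem: "v \<in> C" "w \<in> C" "v' \<in> C" "w' \<in> C"
    and eq: "v + w = v' + w'"
  shows "{v, w} = {v', w'}"
proof -
  \<comment> \<open>Coefficients are counted with multiplicity, so coincidences such as
    \<open>v = w\<close> need no separate treatment.\<close>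
  define U where "U x = (of_bool (x = v) + of_bool (x = w)
      - of_bool (x = v') - of_bool (x = w') :: real)" for x
  have "sum U C = 0" "(\<Sum>x\<in>C. U x *\<^sub>R x) = v + w - v' - w'"
    using C mem by (simp_all add: U_def sum.distrib sum_subtractf scaleR_add_left
        scaleR_diff_left sum.If_cases of_bool_def if_distrib[of "\<lambda>c. c *\<^sub>R _"] cong: if_cong)
  then have "U x = 0" if "x \<in> C" for x
    using C that eq affine_dependent_explicit_finite[OF C(1)] by auto
  then have U: "U v = 0" "U w = 0" "U v' = 0" "U w' = 0"
    using mem by auto
  then show ?thesis
    by (auto simp: U_def of_bool_def split: if_splits)
qed

text \<open>The difference of two affine representations of a common point, one over
  \<open>T\<close> and one over \<open>U\<close>, would be an affine dependence of
  \<open>C\<close>.\<close>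

lemma disjoint_affine_hull_finite:
  fixes C :: "'a::real_vector set"
  assumes "finite C" "\<not> affine_dependent C" "T \<subseteq> C" "U \<subseteq> C" "T \<inter> U = {}"
  shows "affine hull T \<inter> affine hull U = {}"
proof (rule ccontr)
  assume "affine hull T \<inter> affine hull U \<noteq> {}"
  then obtain y where y: "y \<in> affine hull T" "y \<in> affine hull U" by auto
  have fin: "finite T" "finite U" using assms by (auto intro: finite_subset)
  obtain a where a: "sum a T = 1" "(\<Sum>x\<in>T. a x *\<^sub>R x) = y"
    using y(1) fin by (auto simp: affine_hull_finite)
  obtain b where b: "sum b U = 1" "(\<Sum>x\<in>U. b x *\<^sub>R x) = y"
    using y(2) fin by (auto simp: affine_hull_finite)
  define c where "c x = (if x \<in> T then a x else if x \<in> U then - b x else 0)" for x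
  have cT: "c x = a x" if "x \<in> T" for x
    using that by (simp add: c_def)
  have cU: "c x = - b x" if "x \<in> U" for x
    using that assms by (auto simp: c_def)
  have "sum c C = sum c (T \<union> U)"
    by (rule sum.mono_neutral_right) (use assms in \<open>auto simp: c_def\<close>)
  also have "\<dots> = sum a T + sum (\<lambda>x. - b x) U"
    using fin assms(5) by (simp add: sum.union_disjoint cT cU)
  finally have 1: "sum c C = 0"
    using a b by (simp add: sum_negf)
  have "(\<Sum>x\<in>C. c x *\<^sub>R x) = (\<Sum>x\<in>T \<union> U. c x *\<^sub>R x)"
    by (rule sum.mono_neutral_right) (use assms in \<open>auto simp: c_def\<close>)
  also have "\<dots> = (\<Sum>x\<in>T. a x *\<^sub>R x) + (\<Sum>x\<in>U. - (b x *\<^sub>R x))"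
    using fin assms(5) by (simp add: sum.union_disjoint cT cU)
  finally have 2: "(\<Sum>x\<in>C. c x *\<^sub>R x) = 0"
    using a b by (simp add: sum_negf)
  \<comment> \<open>The dependence is nontrivial because the coefficients \<open>a\<close> sum to
    1.\<close>
  obtain x where "x \<in> T" "a x \<noteq> 0"
    using a(1) by (metis sum.neutral zero_neq_one)
  then have "\<exists>x\<in>C. c x \<noteq> 0"
    using cT assms(3) by (metis subsetD)
  with 1 2 show False
    using affine_dependent_explicit_finite[OF assms(1)] assms(2) by blast
qed

lemma convex_hull_face_of_affine_independent:
  fixes C :: "'a::real_vector set"
  assumes "finite C" "\<not> affine_dependent C" "D \<subseteq> C"
  shows "convex hull D face_of convex hull C"
proof -
  have "affine hull D \<inter> affine hull (C - D) = {}"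
    using assms by (intro disjoint_affine_hull_finite[of C]) auto
  then have "affine hull D \<inter> convex hull (C - D) = {}"
    using convex_hull_subset_affine_hull[of "C - D"] by blast
  then show ?thesis
    using assms by (intro face_of_convex_hulls) auto
qed

text \<open>Write \<open>x\<close> in \<open>F\<close> as a convex combination of as few points of
  \<open>C\<close> as possible. Each of them then has positive weight, and the face property pulls
  it into \<open>F\<close>.\<close>

lemma face_of_convex_hull_finite:
  fixes C :: "'a::real_vector set"
  assumes "finite C" "F face_of convex hull C"
  shows "F = convex hull (F \<inter> C)"
proof
  show "convex hull (F \<inter> C) \<subseteq> F"
    using assms(2) by (intro hull_minimal) (auto dest: face_of_imp_convex)
  show "F \<subseteq> convex hull (F \<inter> C)"
  proof
    fix x assume x: "x \<in> F"
    define m where "m = (ARG_MIN card D. D \<subseteq> C \<and> x \<in> convex hull D)"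
    have ex: "C \<subseteq> C \<and> x \<in> convex hull C"
      using x assms(2) face_of_imp_subset by blast
    have m: "m \<subseteq> C" "x \<in> convex hull m"
      using arg_min_natI[of "\<lambda>D. D \<subseteq> C \<and> x \<in> convex hull D" C card, OF ex]
      by (auto simp: m_def)
    have le: "card m \<le> card D" if "D \<subseteq> C" "x \<in> convex hull D" for D
      using arg_min_nat_le[of "\<lambda>D. D \<subseteq> C \<and> x \<in> convex hull D" D card] that
      by (auto simp: m_def)
    have "c \<in> F" if c: "c \<in> m" for c
    proof (cases "m = {c}")
      case True
      then show ?thesis using m x by simp
    next
      case False
      then have "m - {c} \<noteq> {}" using c by auto
      moreover have "m = insert c (m - {c})" using c by auto
      ultimately have "x \<in> {x. \<exists>u\<ge>0. \<exists>v\<ge>0. \<exists>b. u + v = 1 \<and> b \<in> convex hull (m - {c}) \<and>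
          x = u *\<^sub>R c + v *\<^sub>R b}"
        using m(2) convex_hull_insert[of "m - {c}" c] by simp
      then obtain u v b where uvb: "u \<ge> 0" "v \<ge> 0" "u + v = 1" "b \<in> convex hull (m - {c})"
        "x = u *\<^sub>R c + v *\<^sub>R b"
        by blast
      have "finite m" using m(1) assms(1) finite_subset by blast
      \<comment> \<open>If the weight \<open>u\<close> of \<open>c\<close> were 0, then
        \<open>x = b\<close> would lie in the hull of the smaller set
        \<open>m - {c}\<close>.\<close>
      then have "card (m - {c}) < card m" using c by (rule card_Diff1_less)
      then have "x \<notin> convex hull (m - {c})" using le[of "m - {c}"] m(1) by auto
      then have "u \<noteq> 0" using uvb by auto
      have bC: "b \<in> convex hull C"
        using uvb(4) m(1) by (meson Diff_subset hull_mono in_mono order_trans)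
      have cC: "c \<in> convex hull C" using c m(1) by (meson hull_inc in_mono)
      show ?thesis
      proof (cases "v = 0 \<or> b = c")
        case True
        then have "x = c" using uvb by (auto simp flip: scaleR_add_left)
        then show ?thesis using x by simp
      next
        case False
        then have "x \<in> open_segment c b"
          using uvb \<open>u \<noteq> 0\<close> by (auto simp: in_segment intro!: exI[of _ v])
        then show ?thesis
          using face_ofD[OF assms(2) _ cC bC x] by auto
      qed
    qed
    then have "m \<subseteq> F \<inter> C" using m by auto
    then show "x \<in> convex hull (F \<inter> C)" using m(2) hull_mono by blast
  qed
qed

text \<open>The differences from one fixed vertex \<open>a\<close> to the others are a basis of the
  span of all differences.\<close>

lemma affine_dim_convex_hull_affine_independent:
  fixes D :: "'a::real_vector set"
  assumes "finite D" "\<not> affine_dependent D"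
  shows "affine_dim (convex hull D) = int (card D) - 1"
proof (cases "D = {}")
  case True
  then show ?thesis by (simp add: affine_dim_def)
next
  case False
  then obtain a where a: "a \<in> D" by auto
  define B where "B = (\<lambda>x. -a + x) ` (D - {a})"
  have B: "independent B"
    using assms(2) affine_dependent_iff_dependent2[OF a] by (simp add: B_def)
  have card: "card B = card D - 1"
    unfolding B_def using a assms(1) by (subst card_image) (auto simp: inj_on_def)
  have diff: "x - a \<in> span B" if "x \<in> convex hull D" for x
    using that convex_hull_subset_affine_hull[of D] affine_hull_span2[OF a] by (auto simp: B_def)
  have "dim {x - y | x y. x \<in> convex hull D \<and> y \<in> convex hull D} = card B"
  proof (rule dim_unique[OF _ _ B refl])
    show "B \<subseteq> {x - y | x y. x \<in> convex hull D \<and> y \<in> convex hull D}"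
    proof
      fix z assume "z \<in> B"
      then obtain x where "x \<in> D" "z = x - a" by (auto simp: B_def)
      then show "z \<in> {x - y | x y. x \<in> convex hull D \<and> y \<in> convex hull D}"
        using a hull_inc[of _ D convex] by blast
    qed
    show "{x - y | x y. x \<in> convex hull D \<and> y \<in> convex hull D} \<subseteq> span B"
    proof safe
      fix x y assume "x \<in> convex hull D" "y \<in> convex hull D"
      then have "(x - a) - (y - a) \<in> span B"
        by (intro span_diff diff)
      then show "x - y \<in> span B" by simp
    qed
  qed
  moreover have "card D > 0" using a assms(1) card_gt_0_iff by blast
  ultimately show ?thesis
    using False card by (simp add: affine_dim_def)
qed

lemma edges_of_simplex:
  fixes C :: "'a::real_vector set"
  assumes "finite C" "\<not> affine_dependent C"
  shows "{F. F face_of convex hull C \<and> affine_dim F = 1} = (hull) convex ` {D. D \<subseteq> C \<and> card D = 2}"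
proof (intro equalityI subsetI)
  fix F assume F: "F \<in> {F. F face_of convex hull C \<and> affine_dim F = 1}"
  then have eq: "F = convex hull (F \<inter> C)"
    using face_of_convex_hull_finite assms by blast
  have "\<not> affine_dependent (F \<inter> C)"
    using assms(2) affine_dependent_subset[of "F \<inter> C" C] by blast
  then have "affine_dim (convex hull (F \<inter> C)) = int (card (F \<inter> C)) - 1"
    by (rule affine_dim_convex_hull_affine_independent[rotated]) (simp add: assms(1))
  then have "card (F \<inter> C) = 2"
    using F by (simp flip: eq)
  with eq show "F \<in> (hull) convex ` {D. D \<subseteq> C \<and> card D = 2}"
    by blast
next
  fix F assume "F \<in> (hull) convex ` {D. D \<subseteq> C \<and> card D = 2}"
  then obtain D where D: "D \<subseteq> C" "card D = 2" "F = convex hull D" by auto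
  moreover have "finite D" "\<not> affine_dependent D"
    using D assms finite_subset affine_dependent_subset by blast+
  ultimately show "F \<in> {F. F face_of convex hull C \<and> affine_dim F = 1}"
    using convex_hull_face_of_affine_independent[OF assms]
      affine_dim_convex_hull_affine_independent[of D]
    by auto
qed

subsection \<open>Lattice points of unimodular simplices\<close>

text \<open>Used for an affine map \<open>f x + c\<close>: the image of \<open>x/2\<close> is half
  of \<open>(f x + c) + c\<close>, so passing to doubled simplices costs an extra translation by
  \<open>c\<close>.\<close>

lemma half_add_add:
  fixes a c :: "'a::real_vector"
  shows "(1/2) *\<^sub>R ((a + c) + c) = (1/2) *\<^sub>R a + c"
  by (simp add: add.assoc scaleR_add_right flip: scaleR_add_left)

lemma lookup_scaleR:
  fixes x :: "'v \<Rightarrow>\<^sub>0 'a::real_vector"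
  shows "Poly_Mapping.lookup (r *\<^sub>R x) i = r *\<^sub>R Poly_Mapping.lookup x i"
proof -
  have "{i. r *\<^sub>R Poly_Mapping.lookup x i \<noteq> 0} \<subseteq> {i. Poly_Mapping.lookup x i \<noteq> 0}" by auto
  then have "finite {i. r *\<^sub>R Poly_Mapping.lookup x i \<noteq> 0}"
    using finite_lookup finite_subset by blast
  then show ?thesis
    by (simp add: scaleR_poly_mapping_def Abs_poly_mapping_inverse)
qed

lemma linear_lookup: "linear (\<lambda>x :: 'v \<Rightarrow>\<^sub>0 real. Poly_Mapping.lookup x i)"
  by (rule linearI) (simp_all add: lookup_add lookup_scaleR)

lemma int_lattice_iff:
  "x \<in> int_lattice V \<longleftrightarrow>
     (\<forall>i. Poly_Mapping.lookup x i \<in> \<int>) \<and> (\<forall>i. i \<notin> V \<longrightarrow> Poly_Mapping.lookup x i = 0)"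
  by (auto simp: int_lattice_def in_keys_iff subset_iff) (metis Ints_0)

lemma int_lattice_add: "x \<in> int_lattice V \<Longrightarrow> y \<in> int_lattice V \<Longrightarrow> x + y \<in> int_lattice V"
  by (simp add: int_lattice_iff lookup_add)

section \<open>Integral points of the standard simplex and of its double\<close>

definition unit_simplex_vertices :: "nat \<Rightarrow> (nat \<Rightarrow>\<^sub>0 real) set" where
  "unit_simplex_vertices d = insert 0 (basis_vec ` {1..d})"

lemma card_unit_simplex_vertices: "card (unit_simplex_vertices d) = d + 1"
proof -
  have "inj_on (basis_vec :: nat \<Rightarrow> nat \<Rightarrow>\<^sub>0 real) {1..d}"
    by (rule inj_onI) (metis lookup_single_eq lookup_single_not_eq zero_neq_one)
  moreover have "(0 :: nat \<Rightarrow>\<^sub>0 real) \<notin> basis_vec ` {1..d}"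
  proof
    assume "(0 :: nat \<Rightarrow>\<^sub>0 real) \<in> basis_vec ` {1..d}"
    then obtain i where "(0 :: nat \<Rightarrow>\<^sub>0 real) = basis_vec i" by blast
    then have "Poly_Mapping.lookup (0 :: nat \<Rightarrow>\<^sub>0 real) i = 1"
      by (metis lookup_single_eq)
    then show False by simp
  qed
  ultimately show ?thesis
    by (simp add: unit_simplex_vertices_def card_image)
qed

text \<open>The vertices satisfy these inequalities, and the inequalities cut out a convex
  set.\<close>

lemma standard_simplexD:
  assumes "y \<in> standard_simplex d"
  shows "Poly_Mapping.lookup y i \<ge> 0" "(\<Sum>i=1..d. Poly_Mapping.lookup y i) \<le> 1"
proof -
  let ?K = "{y :: nat \<Rightarrow>\<^sub>0 real. (\<forall>i. Poly_Mapping.lookup y i \<ge> 0) \<and>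
      (\<Sum>i=1..d. Poly_Mapping.lookup y i) \<le> 1}"
  have "convex ?K"
  proof (rule convexI, safe)
    fix x y :: "nat \<Rightarrow>\<^sub>0 real" and u v :: real and i
    assume xy: "\<forall>i. Poly_Mapping.lookup x i \<ge> 0" "\<forall>i. Poly_Mapping.lookup y i \<ge> 0"
      "(\<Sum>i=1..d. Poly_Mapping.lookup x i) \<le> 1" "(\<Sum>i=1..d. Poly_Mapping.lookup y i) \<le> 1"
      and uv: "u \<ge> 0" "v \<ge> 0" "u + v = 1"
    show "0 \<le> Poly_Mapping.lookup (u *\<^sub>R x + v *\<^sub>R y) i"
      using xy uv by (simp add: lookup_add lookup_scaleR)
    have "(\<Sum>i=1..d. Poly_Mapping.lookup (u *\<^sub>R x + v *\<^sub>R y) i)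
        = u * (\<Sum>i=1..d. Poly_Mapping.lookup x i) + v * (\<Sum>i=1..d. Poly_Mapping.lookup y i)"
      by (simp add: lookup_add lookup_scaleR sum.distrib sum_distrib_left)
    also have "\<dots> \<le> 1"
      using xy uv by (intro convex_bound_le)
    finally show "(\<Sum>i=1..d. Poly_Mapping.lookup (u *\<^sub>R x + v *\<^sub>R y) i) \<le> 1" .
  qed
  then have "standard_simplex d \<subseteq> ?K"
    unfolding standard_simplex_def
    by (intro hull_minimal) (auto simp: lookup_single when_def)
  then show "Poly_Mapping.lookup y i \<ge> 0" "(\<Sum>i=1..d. Poly_Mapping.lookup y i) \<le> 1"
    using assms by auto
qed

text \<open>A nonzero coordinate is an integer that is at least 1, so one unit vector can be split
  off, lowering the coordinate sum by one. Used with \<open>k = 0\<close> for the standard simplex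
  and with \<open>k = 1\<close> for its double.\<close>

lemma nonneg_int_vector_cases:
  fixes y :: "nat \<Rightarrow>\<^sub>0 real"
  assumes y: "y \<in> int_lattice {1..d}" "\<And>i. Poly_Mapping.lookup y i \<ge> 0"
    "(\<Sum>i=1..d. Poly_Mapping.lookup y i) \<le> real (Suc k)"
  obtains "y = 0"
  | i z where "i \<in> {1..d}" "y = basis_vec i + z" "z \<in> int_lattice {1..d}"
      "\<And>j. Poly_Mapping.lookup z j \<ge> 0" "(\<Sum>i=1..d. Poly_Mapping.lookup z i) \<le> real k"
proof (cases "y = 0")
  case False
  then obtain i where i: "Poly_Mapping.lookup y i \<noteq> 0"
    by (metis lookup_zero poly_mapping_eqI)
  then have id: "i \<in> {1..d}" using y(1) by (auto simp: int_lattice_iff)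
  obtain m where m: "Poly_Mapping.lookup y i = of_int m"
    using y(1) by (metis int_lattice_iff Ints_cases)
  then have m1: "m \<ge> 1" using i y(2)[of i] by auto
  define z where "z = y - basis_vec i"
  have lz: "Poly_Mapping.lookup z j = Poly_Mapping.lookup y j - (if j = i then 1 else 0)" for j
    by (simp add: z_def lookup_minus lookup_single when_def)
  show ?thesis
  proof (rule that(2)[OF id, of z])
    show "y = basis_vec i + z" by (simp add: z_def)
    show "z \<in> int_lattice {1..d}"
      using y(1) id by (auto simp: int_lattice_iff lz)
    show "Poly_Mapping.lookup z j \<ge> 0" for j
      using m m1 y(2) by (auto simp: lz)
    show "(\<Sum>i=1..d. Poly_Mapping.lookup z i) \<le> real k"
    proof -
      have "(\<Sum>j=1..d. if j = i then 1 else 0 :: real) = 1"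
        using id by (subst sum.delta) auto
      then show ?thesis
        using y(3) by (simp add: lz sum_subtractf)
    qed
  qed
qed

lemma integral_point_standard_simplex:
  assumes "y \<in> int_lattice {1..d}" "\<And>i. Poly_Mapping.lookup y i \<ge> 0"
    "(\<Sum>i=1..d. Poly_Mapping.lookup y i) \<le> 1"
  shows "y \<in> unit_simplex_vertices d"
proof -
  have "(\<Sum>i=1..d. Poly_Mapping.lookup y i) \<le> real (Suc 0)"
    using assms(3) by simp
  from nonneg_int_vector_cases[OF assms(1,2) this] show ?thesis
  proof cases
    case 1
    then show ?thesis by (simp add: unit_simplex_vertices_def)
  next
    case (2 i z)
    have "Poly_Mapping.lookup z j = 0" for j
    proof (cases "j \<in> {1..d}")
      case True
      have "Poly_Mapping.lookup z j \<le> (\<Sum>i=1..d. Poly_Mapping.lookup z i)"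
        by (rule member_le_sum) (use True 2 in auto)
      with 2(4)[of j] 2(5) show ?thesis by simp
    next
      case False
      then show ?thesis using 2(3) by (auto simp: int_lattice_iff)
    qed
    then have "z = 0" by (simp add: poly_mapping_eqI)
    with 2 show ?thesis by (simp add: unit_simplex_vertices_def)
  qed
qed

text \<open>After one unit vector is split off, the rest has coordinate sum at most 1 and is
  therefore itself a vertex.\<close>

lemma integral_point_double_standard_simplex:
  assumes "y \<in> int_lattice {1..d}" "(1/2) *\<^sub>R y \<in> standard_simplex d"
  obtains u u' where "u \<in> unit_simplex_vertices d" "u' \<in> unit_simplex_vertices d" "y = u + u'"
proof -
  have nonneg: "Poly_Mapping.lookup y i \<ge> 0" for i
    using standard_simplexD(1)[OF assms(2), of i] by (simp add: lookup_scaleR)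
  have "(\<Sum>i=1..d. Poly_Mapping.lookup y i) \<le> real (Suc 1)"
    using standard_simplexD(2)[OF assms(2)]
    by (simp add: lookup_scaleR flip: sum_divide_distrib)
  from nonneg_int_vector_cases[OF assms(1) nonneg this] show ?thesis
  proof cases
    case 1
    then show ?thesis using that[of 0 0] by (simp add: unit_simplex_vertices_def)
  next
    case (2 i z)
    then have "z \<in> unit_simplex_vertices d"
      by (intro integral_point_standard_simplex) auto
    then show ?thesis
      using that[of "basis_vec i" z] 2 by (simp add: unit_simplex_vertices_def)
  qed
qed

text \<open>Both claims are transported along the lattice equivalence from the standard simplex,
  where they were checked on coordinates.\<close>

lemma unimodular_simplex_lattice_points:
  assumes "0 \<in> L" "finite C" "C \<subseteq> L" "card C = d + 1" "S = convex hull C"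
    and equiv: "lattice_equivalent L S (int_lattice {1..d}) (standard_simplex d)"
  shows "L \<inter> S = C"
    and "\<lbrakk>x \<in> L; (1/2) *\<^sub>R x \<in> S\<rbrakk> \<Longrightarrow> \<exists>v\<in>C. \<exists>w\<in>C. x = v + w"
proof -
  have hull: "affine hull L = span L"
    using assms(1) by (intro affine_hull_span_0 hull_inc)
  obtain f c where f: "linear f" and bij: "bij_betw (\<lambda>x. f x + c) (affine hull L) (affine hull int_lattice {1..d})"
    and L: "(\<lambda>x. f x + c) ` L = int_lattice {1..d}"
    and S: "(\<lambda>x. f x + c) ` S = standard_simplex d"
    using equiv unfolding lattice_equivalent_def by blast
  have inj: "inj_on (\<lambda>x. f x + c) (span L)"
    using bij hull by (auto simp: bij_betw_def)
  have LS: "L \<subseteq> span L" by (rule span_superset)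
  have sub: "(\<lambda>x. f x + c) ` (L \<inter> S) \<subseteq> unit_simplex_vertices d"
  proof
    fix y assume "y \<in> (\<lambda>x. f x + c) ` (L \<inter> S)"
    then have "y \<in> int_lattice {1..d}" "y \<in> standard_simplex d"
      using L S by blast+
    then show "y \<in> unit_simplex_vertices d"
      using standard_simplexD by (intro integral_point_standard_simplex) auto
  qed
  have fin: "finite (unit_simplex_vertices d)" by (simp add: unit_simplex_vertices_def)
  have inj': "inj_on (\<lambda>x. f x + c) (L \<inter> S)"
    using LS by (blast intro: inj_on_subset[OF inj])
  have CLS: "C \<subseteq> L \<inter> S" using assms by (auto intro: hull_inc)
  have finLS: "finite (L \<inter> S)"
    using inj' sub fin by (meson inj_on_finite)
  \<comment> \<open>Counting suffices: \<open>C\<close> already supplies \<open>d + 1\<close>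
    lattice points of \<open>S\<close>, so there are no others.\<close>
  have "card (L \<inter> S) \<le> d + 1"
    using card_inj_on_le[OF inj' sub fin] by (simp add: card_unit_simplex_vertices)
  then show eq: "L \<inter> S = C"
    using card_subset_eq[OF finLS CLS] card_mono[OF finLS CLS] assms(4) by simp
  have "card ((\<lambda>x. f x + c) ` C) = card (unit_simplex_vertices d)"
    using inj' eq assms(4) by (simp add: card_image card_unit_simplex_vertices)
  then have img: "(\<lambda>x. f x + c) ` C = unit_simplex_vertices d"
    using card_subset_eq[OF fin] sub eq by simp
  assume x: "x \<in> L" "(1/2) *\<^sub>R x \<in> S"
  \<comment> \<open>The translation \<open>c\<close> is the image of the lattice point 0.\<close>
  have c: "c \<in> int_lattice {1..d}"
    using L assms(1) linear_0[OF f] by force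
  moreover have "f x + c \<in> int_lattice {1..d}" using L x by blast
  \<comment> \<open>This is twice the image of \<open>x/2\<close>, hence an integral point of the
    doubled standard simplex.\<close>
  ultimately have "(f x + c) + c \<in> int_lattice {1..d}"
    by (rule int_lattice_add[rotated])
  moreover have "(1/2) *\<^sub>R ((f x + c) + c) = f ((1/2) *\<^sub>R x) + c"
    by (simp only: half_add_add linear_scale[OF f])
  then have "(1/2) *\<^sub>R ((f x + c) + c) \<in> standard_simplex d"
    using S x(2) by auto
  ultimately obtain u u' where "u \<in> unit_simplex_vertices d" "u' \<in> unit_simplex_vertices d"
    and sum: "(f x + c) + c = u + u'"
    using integral_point_double_standard_simplex by blast
  then have "u \<in> (\<lambda>x. f x + c) ` C" "u' \<in> (\<lambda>x. f x + c) ` C"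
    by (simp_all only: img)
  then obtain v w where vw: "v \<in> C" "w \<in> C" "u = f v + c" "u' = f w + c"
    by blast
  have cancel: "a + k + k = (b + k) + (e + k) \<Longrightarrow> a = b + e" for a b e k :: "nat \<Rightarrow>\<^sub>0 real"
  proof -
    assume "a + k + k = (b + k) + (e + k)"
    also have "\<dots> = (b + e) + k + k" by (simp only: ac_simps)
    finally show "a = b + e" by (simp only: add_right_cancel)
  qed
  have "f x + c = f (v + w) + c"
    using sum cancel[of "f x" c "f v" "f w"] by (simp only: linear_add[OF f] vw)
  moreover have "v + w \<in> span L" "x \<in> span L"
    using vw assms(3) x(1) by (auto intro: span_add span_base)
  ultimately have "x = v + w"
    using inj_onD[OF inj] by blast
  with vw show "\<exists>v\<in>C. \<exists>w\<in>C. x = v + w" by blast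
qed

subsection \<open>Edges of unimodular triangulations\<close>

lemma card_triangulation_edges:
  assumes L: "0 \<in> L" "\<And>x y. x \<in> L \<Longrightarrow> y \<in> L \<Longrightarrow> x + y \<in> L"
    and P: "convex P" "0 \<in> P"
    and T: "unimodular_triangulation L P T"
  shows "card (triangulation_edges T) =
    card ({v + w | v w. v \<in> L \<inter> P \<and> w \<in> L \<inter> P} - {u + u | u. u \<in> L \<inter> P})"
proof -
  define d where "d = nat (affine_dim P)"
  \<comment> \<open>Since \<open>P\<close> contains 0, its dimension is not the default -1 and
    \<open>nat\<close> loses nothing.\<close>
  have d: "affine_dim P = int d"
    using P by (auto simp: d_def affine_dim_def)
  have un: "\<Union>T = P" and face: "\<And>S S'. S \<in> T \<Longrightarrow> S' \<in> T \<Longrightarrow> S \<inter> S' face_of S"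
    using T by (auto simp: unimodular_triangulation_def lattice_triangulation_def)
  \<comment> \<open>The vertex set of a simplex is recovered as \<open>L \<inter> S\<close>, so no
    choice of vertices has to be carried along.\<close>
  have simplex: "finite (L \<inter> S) \<and> \<not> affine_dependent (L \<inter> S) \<and> S = convex hull (L \<inter> S) \<and>
      (\<forall>x\<in>L. (1/2) *\<^sub>R x \<in> S \<longrightarrow> (\<exists>v\<in>L \<inter> S. \<exists>w\<in>L \<inter> S. x = v + w))" if "S \<in> T" for S
  proof -
    obtain C where C: "C \<subseteq> L" "finite C" "\<not> affine_dependent C" "card C = d + 1" "S = convex hull C"
    proof -
      have "lattice_simplex L (int d) S"
        using T \<open>S \<in> T\<close> by (simp add: d unimodular_triangulation_def lattice_triangulation_def)
      then show ?thesis
        using that by (auto simp: lattice_simplex_def)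
    qed
    have "lattice_equivalent L S (int_lattice {1..d}) (standard_simplex d)"
      using T that by (simp add: unimodular_triangulation_def Let_def d_def)
    note U = unimodular_simplex_lattice_points[OF L(1) C(2,1,4,5) this]
    show ?thesis
    proof (intro conjI ballI impI)
      show "S = convex hull (L \<inter> S)" by (simp only: U(1) C(5)[symmetric])
    qed (use U C in simp_all)
  qed
  define D where "D = {e. card e = 2 \<and> (\<exists>S\<in>T. e \<subseteq> L \<inter> S)}"
  have edges: "triangulation_edges T = (hull) convex ` D"
  proof -
    have "triangulation_edges T = (\<Union>S\<in>T. {F. F face_of S \<and> affine_dim F = 1})"
      by (auto simp: triangulation_edges_def)
    also have "\<dots> = (\<Union>S\<in>T. (hull) convex ` {e. e \<subseteq> L \<inter> S \<and> card e = 2})"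
    proof (rule SUP_cong[OF refl])
      fix S assume S: "S \<in> T"
      have "convex hull (L \<inter> S) = S" using simplex[OF S] by simp
      then show "{F. F face_of S \<and> affine_dim F = 1} = (hull) convex ` {e. e \<subseteq> L \<inter> S \<and> card e = 2}"
        using edges_of_simplex[of "L \<inter> S"] simplex[OF S] by simp
    qed
    also have "\<dots> = (hull) convex ` D"
      by (auto simp: D_def)
    finally show ?thesis .
  qed
  \<comment> \<open>The only lattice points on an edge are its ends: by affine independence no
    vertex of \<open>S\<close> lies in the hull of other vertices. Hence an edge determines its pair
    of ends.\<close>
  have hull_int: "L \<inter> convex hull e = e" if "e \<in> D" for e
  proof -
    obtain S where S: "S \<in> T" "e \<subseteq> L \<inter> S" using \<open>e \<in> D\<close> by (auto simp: D_def)
    have eS: "convex hull e \<subseteq> S"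
      using S simplex hull_mono by metis
    have "x \<in> e" if x: "x \<in> L" "x \<in> convex hull e" for x
    proof (rule ccontr)
      assume "x \<notin> e"
      then have "e \<subseteq> (L \<inter> S) - {x}" using S by auto
      then have "x \<in> affine hull ((L \<inter> S) - {x})"
        using x(2) convex_hull_subset_affine_hull hull_mono by blast
      moreover have "x \<in> L \<inter> S" using x eS by auto
      ultimately show False
        using simplex[OF S(1)] by (auto simp: affine_dependent_def)
    qed
    then show ?thesis using S by (auto intro: hull_inc)
  qed
  have "inj_on ((hull) convex) D"
    using hull_int by (metis inj_onI)
  then have card1: "card (triangulation_edges T) = card D"
    by (simp add: edges card_image)
  \<comment> \<open>The midpoint is interior to the segment and lies in the face
    \<open>S \<inter> S'\<close> of \<open>S\<close>, so both ends lie in that face.\<close>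
  have mid: "v \<in> S' \<and> w \<in> S'"
    if "S \<in> T" "S' \<in> T" "v \<in> S" "w \<in> S" "v \<noteq> w" "(1/2) *\<^sub>R (v + w) \<in> S'" for S S' v w
  proof -
    have m: "(1/2) *\<^sub>R (v + w) \<in> open_segment v w"
      using \<open>v \<noteq> w\<close> by (auto simp: in_segment scaleR_add_right intro!: exI[of _ "1/2"])
    have "convex S" using simplex \<open>S \<in> T\<close> by (metis convex_convex_hull)
    then have "(1/2) *\<^sub>R (v + w) \<in> S"
      using that m by (meson convex_contains_open_segment subsetD)
    then show ?thesis
      using face_ofD[OF face[OF that(1,2)] m] that by auto
  qed
  have pair: "\<exists>v w. e = {v, w} \<and> v \<noteq> w" if "e \<in> D" for e
    using that by (auto simp: D_def card_2_iff)
  have half: "(1/2) *\<^sub>R (v + w) \<in> S" if "v \<in> S" "w \<in> S" "S \<in> T" for v w S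
  proof -
    have "convex S" using simplex \<open>S \<in> T\<close> by (metis convex_convex_hull)
    then show ?thesis
      using that convexD[of S v w "1/2" "1/2"] by (simp add: scaleR_add_right)
  qed
  have "inj_on \<Sum> D"
  proof (rule inj_onI)
    fix e e' assume e: "e \<in> D" "e' \<in> D" "\<Sum>e = \<Sum>e'"
    obtain v w v' w' where vw: "e = {v, w}" "v \<noteq> w" "e' = {v', w'}" "v' \<noteq> w'"
      using pair e by metis
    have eq: "v + w = v' + w'" using e(3) vw by simp
    obtain S S' where S: "S \<in> T" "e \<subseteq> L \<inter> S" "S' \<in> T" "e' \<subseteq> L \<inter> S'"
      using e by (auto simp: D_def)
    have "(1/2) *\<^sub>R (v + w) \<in> S'"
      using half[of v' S' w'] S vw eq by auto
    \<comment> \<open>Both pairs are now among the vertices of the single simplex \<open>S'\<close>,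
      where affine independence applies.\<close>
    then have "v \<in> S'" "w \<in> S'" using mid[of S S' v w] S vw by auto
    then show "e = e'"
      using affine_independent_sum_eqD[of "L \<inter> S'" v w v' w'] simplex[OF S(3)] S vw eq by auto
  qed
  then have card2: "card (\<Sum> ` D) = card D" by (simp add: card_image)
  have "\<Sum> ` D = {v + w | v w. v \<in> L \<inter> P \<and> w \<in> L \<inter> P} - {u + u | u. u \<in> L \<inter> P}" (is "_ = ?X")
  proof (intro equalityI subsetI)
    fix x assume "x \<in> \<Sum> ` D"
    then obtain e where e: "e \<in> D" "x = \<Sum>e" by auto
    then obtain v w where vw: "e = {v, w}" "v \<noteq> w" using pair by blast
    obtain S where S: "S \<in> T" "e \<subseteq> L \<inter> S" using e by (auto simp: D_def)
    have x: "x = v + w" using e vw by simp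
    have "x \<noteq> u + u" if u: "u \<in> L" for u
    proof
      assume "x = u + u"
      then have "(1/2) *\<^sub>R (v + w) = u" using x by (simp add: scaleR_add_right flip: scaleR_add_left)
      \<comment> \<open>If the sum is a double \<open>u + u\<close>, the midpoint \<open>u\<close>
        is a vertex of the same simplex, which contradicts affine independence.\<close>
      then have "u \<in> L \<inter> S" using half[of v S w] S vw u by auto
      then have "{v, w} = {u, u}"
        using affine_independent_sum_eqD[of "L \<inter> S" v w u u] simplex[OF S(1)] S vw x \<open>x = u + u\<close>
        by auto
      then show False using vw by auto
    qed
    then show "x \<in> ?X"
      using x vw S un by auto
  next
    fix x assume x: "x \<in> ?X"
    then obtain v w where vw: "v \<in> L \<inter> P" "w \<in> L \<inter> P" "x = v + w" by blast
    have "x \<in> L" using vw L by auto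
    have "(1/2) *\<^sub>R x \<in> P"
      using convexD[OF P(1), of v w "1/2" "1/2"] vw by (simp add: scaleR_add_right)
    \<comment> \<open>The given \<open>v\<close>, \<open>w\<close> need not span an edge; a simplex
      containing \<open>x/2\<close> supplies another decomposition that does.\<close>
    then obtain S where S: "S \<in> T" "(1/2) *\<^sub>R x \<in> S" using un by auto
    then obtain v' w' where v': "v' \<in> L \<inter> S" "w' \<in> L \<inter> S" "x = v' + w'"
      using simplex \<open>x \<in> L\<close> by blast
    then have "v' \<noteq> w'" using x S un by auto
    then have "{v', w'} \<in> D" "x = \<Sum>{v', w'}"
      using v' S by (auto simp: D_def)
    then show "x \<in> \<Sum> ` D" by blast
  qed
  with card1 card2 show ?thesis by simp
qed

subsection \<open>Lattice points of symmetric edge polytopes\<close>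

text \<open>Both signs are included, because \<open>{i, j} = {j, i}\<close>.\<close>

definition edge_vectors :: "'v set set \<Rightarrow> ('v \<Rightarrow>\<^sub>0 real) set" where
  "edge_vectors E = {basis_vec i - basis_vec j | i j. {i, j} \<in> E}"

lemma edge_vectorsI: "{i, j} \<in> E \<Longrightarrow> basis_vec i - basis_vec j \<in> edge_vectors E"
  by (auto simp: edge_vectors_def)

lemma symmetric_edge_polytope_eq: "symmetric_edge_polytope E = convex hull edge_vectors E"
proof -
  have "(\<Union>{{basis_vec i - basis_vec j, - (basis_vec i - basis_vec j)} | i j. {i, j} \<in> E})
      = edge_vectors E"
  proof (intro equalityI subsetI)
    fix x :: "'a \<Rightarrow>\<^sub>0 real"
    assume "x \<in> (\<Union>{{basis_vec i - basis_vec j, - (basis_vec i - basis_vec j)} | i j. {i, j} \<in> E})"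
    then obtain i j where ij: "{i, j} \<in> E"
      "x = basis_vec i - basis_vec j \<or> x = basis_vec j - basis_vec i"
      by auto
    have "{j, i} \<in> E" using ij(1) by (simp add: insert_commute)
    then show "x \<in> edge_vectors E"
      using ij(2) edge_vectorsI[OF ij(1)] edge_vectorsI[of j i E] by auto
  next
    fix x :: "'a \<Rightarrow>\<^sub>0 real"
    assume "x \<in> edge_vectors E"
    then obtain i j where "{i, j} \<in> E" "x = basis_vec i - basis_vec j"
      by (auto simp: edge_vectors_def)
    then show "x \<in> (\<Union>{{basis_vec i - basis_vec j, - (basis_vec i - basis_vec j)} | i j. {i, j} \<in> E})"
      by (intro UnionI[of "{basis_vec i - basis_vec j, - (basis_vec i - basis_vec j)}"]) auto
  qed
  then show ?thesis by (simp add: symmetric_edge_polytope_def)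
qed

lemma uminus_edge_vectors:
  assumes "r \<in> edge_vectors E"
  shows "- r \<in> edge_vectors E"
proof -
  obtain i j where ij: "{i, j} \<in> E" "r = basis_vec i - basis_vec j"
    using assms by (auto simp: edge_vectors_def)
  then have "{j, i} \<in> E" by (simp add: insert_commute)
  from edge_vectorsI[OF this] show ?thesis by (simp add: ij)
qed

lemma zero_in_convex_hull_edge_vectors:
  assumes "r \<in> edge_vectors E"
  shows "0 \<in> convex hull edge_vectors E"
proof -
  have "(1/2) *\<^sub>R r + (1/2) *\<^sub>R (- r) \<in> convex hull edge_vectors E"
    using assms by (intro convexD[OF convex_convex_hull] hull_inc uminus_edge_vectors) auto
  then show ?thesis by simp
qed

lemma convex_le_linear:
  assumes "linear f"
  shows "convex {x. f x \<le> (c::real)}"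
proof (rule convexI)
  fix x y and u v :: real
  assume "x \<in> {x. f x \<le> c}" "y \<in> {x. f x \<le> c}" "0 \<le> u" "0 \<le> v" "u + v = 1"
  then show "u *\<^sub>R x + v *\<^sub>R y \<in> {x. f x \<le> c}"
    by (simp add: linear_add[OF assms] linear_scale[OF assms] convex_bound_le)
qed

lemma lookup_basis_diff:
  "Poly_Mapping.lookup (basis_vec i - basis_vec j :: 'v \<Rightarrow>\<^sub>0 real) k = of_bool (i = k) - of_bool (j = k)"
  by (simp add: lookup_minus lookup_single when_def)

text \<open>A nonzero integral point \<open>x\<close> has coordinate sum 0, hence a coordinate at
  least 1 at some \<open>i\<close> and one at most -1 at some \<open>j\<close>. The functional
  \<open>x_i - x_j\<close> is at least 2 there, but among the edge vectors only
  \<open>e_i - e_j\<close> exceeds 1, so \<open>x\<close> is that vector.\<close>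

lemma lattice_points_symmetric_edge_polytope:
  assumes V: "finite V" and E: "\<And>e. e \<in> E \<Longrightarrow> e \<subseteq> V \<and> card e = 2" and "E \<noteq> {}"
  shows "sep_lattice V E \<inter> symmetric_edge_polytope E = insert 0 (edge_vectors E)"
proof (intro equalityI subsetI)
  have ij: "i \<noteq> j \<and> i \<in> V \<and> j \<in> V" if "{i, j} \<in> E" for i j
    using E[OF that] by (auto simp: card_2_iff doubleton_eq_iff)
  obtain e where "e \<in> E" using assms(3) by blast
  then have "card e = 2" using E by blast
  then obtain i j where "e = {i, j}" by (meson card_2_iff)
  with \<open>e \<in> E\<close> have "{i, j} \<in> E" by simp
  then have 0: "0 \<in> convex hull edge_vectors E"
    by (rule zero_in_convex_hull_edge_vectors[OF edge_vectorsI])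
  fix x
  {
    assume x: "x \<in> insert 0 (edge_vectors E)"
    then have "x \<in> symmetric_edge_polytope E"
      using 0 by (auto simp: symmetric_edge_polytope_eq intro: hull_inc)
    moreover have "x \<in> int_lattice V"
    proof (cases "x = 0")
      case False
      then obtain k l where kl: "{k, l} \<in> E" "x = basis_vec k - basis_vec l"
        using x by (auto simp: edge_vectors_def)
      have "k \<in> V" "l \<in> V" using ij[OF kl(1)] by auto
      then show ?thesis
        by (auto simp: kl(2) int_lattice_iff lookup_basis_diff)
    qed (simp add: int_lattice_iff)
    ultimately show "x \<in> sep_lattice V E \<inter> symmetric_edge_polytope E"
      by (simp add: sep_lattice_def hull_inc)
  }
  assume x: "x \<in> sep_lattice V E \<inter> symmetric_edge_polytope E"
  then have hull: "x \<in> convex hull edge_vectors E" and int: "x \<in> int_lattice V"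
    by (auto simp: sep_lattice_def symmetric_edge_polytope_eq)
  let ?l = Poly_Mapping.lookup
  have outside: "?l x k = 0" if "k \<notin> V" for k
    using int that by (simp add: int_lattice_iff)
  have "edge_vectors E \<subseteq> {y. (\<Sum>k\<in>V. ?l y k) = 0}"
  proof
    fix y assume "y \<in> edge_vectors E"
    then obtain k l where kl: "{k, l} \<in> E" "y = basis_vec k - basis_vec l"
      by (auto simp: edge_vectors_def)
    have "k \<in> V" "l \<in> V" using ij[OF kl(1)] by auto
    then show "y \<in> {y. (\<Sum>k\<in>V. ?l y k) = 0}"
      using V by (simp add: kl(2) lookup_basis_diff sum_subtractf of_bool_def)
  qed
  moreover have "convex {y :: 'a \<Rightarrow>\<^sub>0 real. (\<Sum>k\<in>V. ?l y k) = 0}"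
    by (rule convexI) (simp add: lookup_add lookup_scaleR sum.distrib flip: sum_distrib_left)
  ultimately have sum: "(\<Sum>k\<in>V. ?l x k) = 0"
    using hull hull_minimal[of "edge_vectors E" _ convex] by blast
  show "x \<in> insert 0 (edge_vectors E)"
  proof (cases "x = 0")
    case False
    then obtain k where k: "?l x k \<noteq> 0"
      by (metis lookup_zero poly_mapping_eqI)
    then have "k \<in> V" using outside by blast
    have "\<exists>i. ?l x i > 0"
    proof (rule ccontr)
      assume "\<not> (\<exists>i. ?l x i > 0)"
      then have "\<And>i. ?l x i \<le> 0" by (simp add: not_less)
      then have "\<forall>i\<in>V. ?l x i = 0"
        using sum_nonneg_eq_0_iff[OF V, of "\<lambda>i. - ?l x i"] sum by (auto simp: sum_negf)
      then show False using k \<open>k \<in> V\<close> by blast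
    qed
    then obtain i where i: "?l x i > 0" by blast
    have "\<exists>j. ?l x j < 0"
    proof (rule ccontr)
      assume "\<not> (\<exists>j. ?l x j < 0)"
      then have "\<And>i. ?l x i \<ge> 0" by (simp add: not_less)
      then have "\<forall>i\<in>V. ?l x i = 0"
        using sum_nonneg_eq_0_iff[OF V, of "?l x"] sum by auto
      then show False using k \<open>k \<in> V\<close> by blast
    qed
    then obtain j where j: "?l x j < 0" by blast
    define \<phi> :: "('a \<Rightarrow>\<^sub>0 real) \<Rightarrow> real" where "\<phi> y = ?l y i - ?l y j" for y
    have lin: "linear \<phi>"
      unfolding \<phi>_def by (intro linear_compose_sub linear_lookup)
    have "?l x i \<in> \<int>" "?l x j \<in> \<int>" using int by (auto simp: int_lattice_iff)
    then obtain a b where ab: "?l x i = of_int a" "?l x j = of_int b"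
      by (elim Ints_cases)
    have "a \<ge> 1" "b \<le> - 1" using i j ab by simp_all
    then have \<phi>x: "\<phi> x \<ge> 2"
      using ab by (simp add: \<phi>_def)
    define r where "r = (basis_vec i - basis_vec j :: 'a \<Rightarrow>\<^sub>0 real)"
    have "i \<noteq> j" using i j by auto
    have le1: "\<phi> y \<le> 1" if y: "y \<in> edge_vectors E" "y \<noteq> r" for y
    proof -
      obtain k l where kl: "{k, l} \<in> E" "y = basis_vec k - basis_vec l"
        using y(1) by (auto simp: edge_vectors_def)
      have "k \<noteq> i \<or> l \<noteq> j" using y(2) kl by (auto simp: r_def)
      then show ?thesis
        using \<open>i \<noteq> j\<close> ij[OF kl(1)] by (auto simp: kl(2) \<phi>_def lookup_basis_diff of_bool_def)
    qed
    have hull1: "\<phi> y \<le> 1" if "y \<in> convex hull (edge_vectors E - {r})" for y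
    proof -
      have "convex hull (edge_vectors E - {r}) \<subseteq> {y. \<phi> y \<le> 1}"
        by (intro hull_minimal convex_le_linear lin) (auto intro: le1)
      then show ?thesis using that by blast
    qed
    \<comment> \<open>Otherwise the bound 1 would hold on all generators and hence at
      \<open>x\<close>.\<close>
    have r: "r \<in> edge_vectors E"
    proof (rule ccontr)
      assume "r \<notin> edge_vectors E"
      then show False using hull1[of x] hull \<phi>x by simp
    qed
    \<comment> \<open>Splitting \<open>r\<close> off the hull with \<open>convex_hull_insert\<close>
      requires the remaining set to be nonempty.\<close>
    have "- r \<in> edge_vectors E - {r}"
    proof -
      have "- r \<in> edge_vectors E"
        using r by (rule uminus_edge_vectors)
      moreover have "?l (- r) i \<noteq> ?l r i"
        using \<open>i \<noteq> j\<close> by (simp add: r_def lookup_basis_diff)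
      then have "- r \<noteq> r" by metis
      ultimately show ?thesis by simp
    qed
    then have "edge_vectors E - {r} \<noteq> {}" by blast
    then have "x \<in> {x. \<exists>u\<ge>0. \<exists>v\<ge>0. \<exists>b. u + v = 1 \<and> b \<in> convex hull (edge_vectors E - {r}) \<and>
        x = u *\<^sub>R r + v *\<^sub>R b}"
      using hull r convex_hull_insert[of "edge_vectors E - {r}" r] by (simp add: insert_absorb)
    then obtain u v b where uvb: "u \<ge> 0" "v \<ge> 0" "u + v = 1"
      "b \<in> convex hull (edge_vectors E - {r})" "x = u *\<^sub>R r + v *\<^sub>R b"
      by blast
    have "\<phi> r = 2"
      using \<open>i \<noteq> j\<close> by (simp add: r_def \<phi>_def lookup_basis_diff)
    \<comment> \<open>Any weight \<open>v > 0\<close> away from \<open>r\<close> would push the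
      value of the functional below 2.\<close>
    then have "2 \<le> u * 2 + v * \<phi> b"
      using \<phi>x uvb(5) by (simp add: linear_add[OF lin] linear_scale[OF lin])
    also have "\<dots> \<le> u * 2 + v * 1"
      using hull1[OF uvb(4)] uvb(2) by (intro add_left_mono mult_left_mono)
    finally have "v = 0" "u = 1" using uvb(1-3) by simp_all
    then show ?thesis using uvb(5) r by simp
  qed simp
qed

lemma card_triangulation_edges_sep:
  assumes V: "finite V" and E: "\<And>e. e \<in> E \<Longrightarrow> e \<subseteq> V \<and> card e = 2"
    and T: "unimodular_triangulation (sep_lattice V E) (symmetric_edge_polytope E) T"
  shows "card (triangulation_edges T) =
    card ({v + w | v w. v \<in> insert 0 (edge_vectors E) \<and> w \<in> insert 0 (edge_vectors E)}
      - {u + u | u. u \<in> insert 0 (edge_vectors E)})"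
proof (cases "E = {}")
  case True
  \<comment> \<open>Without arcs the polytope is empty and has no edges; on the other side the only
    sum is 0, which is the double of 0.\<close>
  then have ev: "edge_vectors E = {}" by (simp add: edge_vectors_def)
  have "\<Union>T = symmetric_edge_polytope E"
    using T by (simp add: unimodular_triangulation_def lattice_triangulation_def)
  then have "\<Union>T = {}" by (simp add: symmetric_edge_polytope_eq ev)
  then have "triangulation_edges T = {}"
    by (auto simp: triangulation_edges_def affine_dim_def dest: face_of_imp_subset)
  moreover have "{v + w | v w :: 'a \<Rightarrow>\<^sub>0 real. v \<in> {0} \<and> w \<in> {0}} - {u + u | u. u \<in> {0}} = {}"
    by auto
  ultimately show ?thesis by (simp only: ev card.empty)
next
  case False
  note points = lattice_points_symmetric_edge_polytope[OF V E False]
  let ?P = "symmetric_edge_polytope E"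
  have P: "convex ?P" "0 \<in> ?P"
    using points by (auto simp: symmetric_edge_polytope_eq)
  \<comment> \<open>As 0 lies in the polytope, the affine hull is a linear subspace, which makes
    \<open>sep_lattice\<close> closed under addition.\<close>
  then have hull: "affine hull ?P = span ?P"
    by (intro affine_hull_span_0 hull_inc)
  have "card (triangulation_edges T) =
      card ({v + w | v w. v \<in> sep_lattice V E \<inter> ?P \<and> w \<in> sep_lattice V E \<inter> ?P}
        - {u + u | u. u \<in> sep_lattice V E \<inter> ?P})"
  proof (rule card_triangulation_edges[OF _ _ P T])
    show "0 \<in> sep_lattice V E" using points by blast
    show "x + y \<in> sep_lattice V E" if "x \<in> sep_lattice V E" "y \<in> sep_lattice V E" for x y
      using that by (auto simp: sep_lattice_def hull int_lattice_add span_add)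
  qed
  then show ?thesis by (simp only: points)
qed

subsection \<open>Sums of two edge vectors\<close>

definition indicator_vec :: "'v set \<Rightarrow> ('v \<Rightarrow>\<^sub>0 real)" where
  "indicator_vec B = (\<Sum>i\<in>B. basis_vec i)"

lemma lookup_indicator_vec:
  "finite B \<Longrightarrow> Poly_Mapping.lookup (indicator_vec B) k = of_bool (k \<in> B)"
  by (simp add: indicator_vec_def lookup_sum lookup_single when_def of_bool_def)

definition pair_vec :: "'v \<times> 'v \<Rightarrow> ('v \<Rightarrow>\<^sub>0 real)" where
  "pair_vec = (\<lambda>(i, j). basis_vec i - basis_vec j)"

definition star_vec :: "'v \<times> 'v set \<Rightarrow> ('v \<Rightarrow>\<^sub>0 real)" where
  "star_vec = (\<lambda>(i, B). basis_vec i + basis_vec i - indicator_vec B)"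

definition matching_vec :: "'v set \<times> 'v set \<Rightarrow> ('v \<Rightarrow>\<^sub>0 real)" where
  "matching_vec = (\<lambda>(B, C). indicator_vec B - indicator_vec C)"

text \<open>The pairs are ordered, since \<open>(i, j)\<close> and \<open>(j, i)\<close> index
  opposite vectors.\<close>

definition adjacent_or_linked_pairs :: "'v set \<Rightarrow> 'v set set \<Rightarrow> ('v \<times> 'v) set" where
  "adjacent_or_linked_pairs V E = {(i, j). i \<in> V \<and> j \<in> V \<and> i \<noteq> j \<and>
     ({i, j} \<in> E \<or> (\<exists>k\<in>V - {i, j}. {i, k} \<in> E \<and> {k, j} \<in> E))}"

text \<open>The leaves form an unordered pair \<open>B\<close>. Each star indexes two vectors,
  \<open>star_vec\<close> and its negative.\<close>

definition two_stars :: "'v set \<Rightarrow> 'v set set \<Rightarrow> ('v \<times> 'v set) set" where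
  "two_stars V E = {(i, B). i \<in> V \<and> B \<subseteq> V - {i} \<and> card B = 2 \<and> (\<forall>j\<in>B. {i, j} \<in> E)}"

text \<open>The existential over labellings says that at least one of the two perfect matchings
  between \<open>B\<close> and \<open>C\<close> consists of arcs. Swapping \<open>B\<close> and
  \<open>C\<close> gives the opposite vector.\<close>

definition matched_pairs :: "'v set \<Rightarrow> 'v set set \<Rightarrow> ('v set \<times> 'v set) set" where
  "matched_pairs V E = {(B, C). B \<subseteq> V \<and> C \<subseteq> V - B \<and> card B = 2 \<and> card C = 2 \<and>
     (\<exists>i j k l. B = {i, j} \<and> C = {k, l} \<and> {i, k} \<in> E \<and> {j, l} \<in> E)}"

text \<open>
  The four sets below determine which of the kinds of vectors above \<open>x\<close> belongs to, and its index.
\<close>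

definition level_sets :: "('v \<Rightarrow>\<^sub>0 real) \<Rightarrow> 'v set \<times> 'v set \<times> 'v set \<times> 'v set" where
  "level_sets x = ({i. Poly_Mapping.lookup x i = 2}, {i. Poly_Mapping.lookup x i = 1},
     {i. Poly_Mapping.lookup x i = -1}, {i. Poly_Mapping.lookup x i = -2})"

section \<open>Recovering kind and index of a vector from its level sets\<close>

lemma level_sets_pair_vec:
  assumes "i \<noteq> j"
  shows "level_sets (pair_vec (i, j)) = ({}, {i}, {j}, {})"
  using assms by (auto simp: level_sets_def pair_vec_def lookup_basis_diff of_bool_def split: if_splits)

lemma lookup_star_vec:
  assumes "finite B"
  shows "Poly_Mapping.lookup (star_vec (i, B)) k = 2 * of_bool (k = i) - of_bool (k \<in> B)"
  using assms
  by (simp add: star_vec_def lookup_minus lookup_add lookup_indicator_vec lookup_single when_def of_bool_def)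

lemma level_sets_star_vec:
  assumes "finite B" "i \<notin> B"
  shows "level_sets (star_vec (i, B)) = ({i}, {}, B, {})"
    and "level_sets (- star_vec (i, B)) = ({}, B, {}, {i})"
  using assms by (auto simp: level_sets_def lookup_star_vec of_bool_def split: if_splits)

lemma level_sets_matching_vec:
  assumes "finite B" "finite C" "B \<inter> C = {}"
  shows "level_sets (matching_vec (B, C)) = ({}, B, C, {})"
  using assms
  by (auto simp: level_sets_def matching_vec_def lookup_minus lookup_indicator_vec of_bool_def split: if_splits)

lemma indicator_vec_doubleton: "i \<noteq> j \<Longrightarrow> indicator_vec {i, j} = basis_vec i + basis_vec j"
  by (simp add: indicator_vec_def)

text \<open>The coordinates of \<open>u + u\<close> are even integers. Every vector of the four
  kinds has a coordinate 1 or -1, so none of them is a double.\<close>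

lemma doubled_edge_vector_level_sets:
  assumes "u \<in> insert 0 (edge_vectors E)" "level_sets (u + u) = (A, B, C, D)"
  shows "B = {}" "C = {}"
proof -
  have "Poly_Mapping.lookup u i \<in> \<int>" for i
    using assms(1) by (auto simp: edge_vectors_def lookup_basis_diff)
  then have "Poly_Mapping.lookup (u + u) i \<noteq> 1 \<and> Poly_Mapping.lookup (u + u) i \<noteq> - 1" for i
  proof -
    obtain m where "Poly_Mapping.lookup u i = of_int m"
      using \<open>Poly_Mapping.lookup u i \<in> \<int>\<close> by (elim Ints_cases)
    then have "Poly_Mapping.lookup (u + u) i = of_int (2 * m)"
      by (simp add: lookup_add)
    moreover have "2 * m \<noteq> 1" "2 * m \<noteq> - 1" by presburger+
    ultimately show ?thesis
      by (metis of_int_1 of_int_eq_iff of_int_minus)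
  qed
  then show "B = {}" "C = {}" using assms(2) by (auto simp: level_sets_def)
qed

lemma sums_of_edge_vectors:
  assumes V: "finite V" and E: "\<And>e. e \<in> E \<Longrightarrow> e \<subseteq> V \<and> card e = 2"
  shows "{v + w | v w. v \<in> insert 0 (edge_vectors E) \<and> w \<in> insert 0 (edge_vectors E)}
      - {u + u | u. u \<in> insert 0 (edge_vectors E)}
    = pair_vec ` adjacent_or_linked_pairs V E \<union> star_vec ` two_stars V E
      \<union> (\<lambda>x. - star_vec x) ` two_stars V E \<union> matching_vec ` matched_pairs V E" (is "?S - ?D = ?R")
proof (intro equalityI subsetI)
  have arc: "i \<noteq> j \<and> i \<in> V \<and> j \<in> V" if "{i, j} \<in> E" for i j
    using E[OF that] by (auto simp: card_2_iff doubleton_eq_iff)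
  fix x
  {
    assume x: "x \<in> ?S - ?D"
    have single: "x \<in> ?R" if x_edge: "x \<in> edge_vectors E"
    proof -
      obtain i j where ij: "{i, j} \<in> E" "x = basis_vec i - basis_vec j"
        using x_edge by (auto simp: edge_vectors_def)
      then have "(i, j) \<in> adjacent_or_linked_pairs V E" "x = pair_vec (i, j)"
        using arc[OF ij(1)] by (auto simp: adjacent_or_linked_pairs_def pair_vec_def)
      then show ?thesis by blast
    qed
    have no_double: "x \<noteq> u + u" if "u \<in> insert 0 (edge_vectors E)" for u
      using x that by blast
    obtain v w where vw: "v \<in> insert 0 (edge_vectors E)" "w \<in> insert 0 (edge_vectors E)" "x = v + w"
      using x by blast
    show "x \<in> ?R"
    proof (cases "v = 0 \<or> w = 0")
      case True
      then have "x \<in> insert 0 (edge_vectors E)" using vw by auto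
      moreover have "x \<noteq> 0" using no_double[of 0] by simp
      ultimately show ?thesis using single by simp
    next
      case False
      then have v: "v \<in> edge_vectors E" and w: "w \<in> edge_vectors E" using vw by auto
      obtain i j where ij: "{i, j} \<in> E" "v = basis_vec i - basis_vec j"
        using v by (auto simp: edge_vectors_def)
      obtain k l where kl: "{k, l} \<in> E" "w = basis_vec k - basis_vec l"
        using w by (auto simp: edge_vectors_def)
      have x_eq: "x = basis_vec i - basis_vec j + (basis_vec k - basis_vec l)"
        by (simp only: vw(3) ij(2) kl(2))
      note arcs = arc[OF ij(1)] arc[OF kl(1)]
      have ji: "{j, i} \<in> E" "{l, k} \<in> E" using ij(1) kl(1) by (simp_all add: insert_commute)
      \<comment> \<open>The split follows which ends of the two directed arcs cancel
        (\<open>i = l\<close>, \<open>j = k\<close>) or coincide (\<open>i = k\<close>,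
        \<open>j = l\<close>). Double cancellation gives \<open>0 + 0\<close> and double coincidence
        gives \<open>v + v\<close>; both are excluded as doubles.\<close>
      consider "i = l" "j = k" | "i = l" "j \<noteq> k" | "i \<noteq> l" "j = k" | "i = k" "j = l"
        | "i = k" "j \<noteq> l" | "i \<noteq> k" "j = l" | "i \<noteq> k" "j \<noteq> l" "i \<noteq> l" "j \<noteq> k"
        by blast
      then show ?thesis
      proof cases
        case 1
        then have "x = 0 + 0" by (simp add: x_eq)
        then show ?thesis using no_double[of 0] by blast
      next
        case 2
        then have "(k, j) \<in> adjacent_or_linked_pairs V E"
          using arcs ij kl by (auto simp: adjacent_or_linked_pairs_def)
        moreover have "x = pair_vec (k, j)" using 2 by (simp add: x_eq pair_vec_def)
        ultimately show ?thesis by blast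
      next
        case 3
        then have "(i, l) \<in> adjacent_or_linked_pairs V E"
          using arcs ij kl by (auto simp: adjacent_or_linked_pairs_def)
        moreover have "x = pair_vec (i, l)" using 3 by (simp add: x_eq pair_vec_def)
        ultimately show ?thesis by blast
      next
        case 4
        then have "x = v + v" using ij by (simp add: x_eq)
        then show ?thesis using no_double[of v] v by blast
      next
        case 5
        then have "(i, {j, l}) \<in> two_stars V E"
          using arcs ij kl by (auto simp: two_stars_def)
        moreover have "x = star_vec (i, {j, l})"
          using 5 by (simp add: x_eq star_vec_def indicator_vec_doubleton)
        ultimately show ?thesis by blast
      next
        case 6
        then have "(j, {i, k}) \<in> two_stars V E"
          using arcs ji by (auto simp: two_stars_def)
        moreover have "x = - star_vec (j, {i, k})"
          using 6 by (simp add: x_eq star_vec_def indicator_vec_doubleton)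
        ultimately show ?thesis by blast
      next
        case 7
        then have "card {i, k} = 2" "card {j, l} = 2" "{i, k} \<subseteq> V" "{j, l} \<subseteq> V - {i, k}"
          using arcs by auto
        then have "({i, k}, {j, l}) \<in> matched_pairs V E"
          using ij kl unfolding matched_pairs_def by blast
        moreover have "x = matching_vec ({i, k}, {j, l})"
          using 7 by (simp add: x_eq matching_vec_def indicator_vec_doubleton)
        ultimately show ?thesis by blast
      qed
    qed
  }
  have memI: "x \<in> ?S - ?D"
    if "v \<in> insert 0 (edge_vectors E)" "w \<in> insert 0 (edge_vectors E)" "x = v + w"
      "level_sets x = (A, B, C, D)" "B \<noteq> {} \<or> C \<noteq> {}" for v w A B C D
    using that doubled_edge_vector_level_sets by blast
  assume "x \<in> ?R"
  then consider (path) i j where "(i, j) \<in> adjacent_or_linked_pairs V E" "x = pair_vec (i, j)"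
    | (star) i B where "(i, B) \<in> two_stars V E" "x = star_vec (i, B) \<or> x = - star_vec (i, B)"
    | (matching) B C where "(B, C) \<in> matched_pairs V E" "x = matching_vec (B, C)"
    by fast
  then show "x \<in> ?S - ?D"
  proof cases
    case path
    then have "i \<noteq> j" and "{i, j} \<in> E \<or> (\<exists>k. {i, k} \<in> E \<and> {k, j} \<in> E)"
      by (auto simp: adjacent_or_linked_pairs_def)
    then obtain v w where "v \<in> insert 0 (edge_vectors E)" "w \<in> insert 0 (edge_vectors E)" "x = v + w"
    proof (elim disjE exE conjE)
      assume "{i, j} \<in> E"
      then show ?thesis
        using that[of "pair_vec (i, j)" 0] path(2) edge_vectorsI[of i j E] by (simp add: pair_vec_def)
    next
      fix k assume "{i, k} \<in> E" "{k, j} \<in> E"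
      then show ?thesis
        using that[of "basis_vec i - basis_vec k" "basis_vec k - basis_vec j"] path(2)
          edge_vectorsI[of i k E] edge_vectorsI[of k j E] by (simp add: pair_vec_def)
    qed
    then show ?thesis
      by (rule memI) (use path(2) level_sets_pair_vec[OF \<open>i \<noteq> j\<close>] in auto)
  next
    case star
    then have B: "finite B" "i \<notin> B" "card B = 2" "\<And>j. j \<in> B \<Longrightarrow> {i, j} \<in> E"
      by (auto simp: two_stars_def intro: card_ge_0_finite)
    then obtain j k where jk: "B = {j, k}" "j \<noteq> k" by (meson card_2_iff)
    have mem: "basis_vec i - basis_vec j \<in> edge_vectors E" "basis_vec i - basis_vec k \<in> edge_vectors E"
      using B jk by (auto intro: edge_vectorsI)
    have eq: "star_vec (i, B) = (basis_vec i - basis_vec j) + (basis_vec i - basis_vec k)"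
      by (simp add: star_vec_def jk indicator_vec_doubleton)
    note ls = level_sets_star_vec[OF B(1,2)]
    from star(2) show ?thesis
    proof
      assume x: "x = star_vec (i, B)"
      show ?thesis
        by (rule memI[OF _ _ x[unfolded eq]]) (use mem ls(1) jk x in auto)
    next
      assume x: "x = - star_vec (i, B)"
      have x': "x = - (basis_vec i - basis_vec j) + - (basis_vec i - basis_vec k)"
        unfolding x eq by (rule minus_add_distrib)
      show ?thesis
        by (rule memI[OF _ _ x']) (use uminus_edge_vectors[OF mem(1)] uminus_edge_vectors[OF mem(2)] ls(2) jk x in auto)
    qed
  next
    case matching
    then obtain i j k l where ijkl: "B = {i, j}" "C = {k, l}" "{i, k} \<in> E" "{j, l} \<in> E"
      and BC: "card B = 2" "card C = 2" "B \<inter> C = {}"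
      by (auto simp: matched_pairs_def)
    then have "i \<noteq> j" "k \<noteq> l" by (auto simp: card_insert_if split: if_splits)
    then have eq: "x = (basis_vec i - basis_vec k) + (basis_vec j - basis_vec l)"
      using matching(2) ijkl by (simp add: matching_vec_def indicator_vec_doubleton)
    have "level_sets x = ({}, B, C, {})"
      unfolding matching(2) using BC ijkl(1,2) by (intro level_sets_matching_vec) auto
    then show ?thesis
      by (rule memI[OF _ _ eq, rotated 2])
        (use ijkl in \<open>auto intro: edge_vectorsI\<close>)
  qed
qed

text \<open>Level sets determine kind and index, so the four families are disjoint and each is
  injectively indexed.\<close>

lemma card_sums_of_edge_vectors:
  assumes V: "finite V" and E: "\<And>e. e \<in> E \<Longrightarrow> e \<subseteq> V \<and> card e = 2"
  shows "card ({v + w | v w. v \<in> insert 0 (edge_vectors E) \<and> w \<in> insert 0 (edge_vectors E)}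
      - {u + u | u. u \<in> insert 0 (edge_vectors E)})
    = card (adjacent_or_linked_pairs V E) + 2 * card (two_stars V E) + card (matched_pairs V E)"
proof -
  let ?A = "adjacent_or_linked_pairs V E" and ?B = "two_stars V E" and ?C = "matched_pairs V E"
  let ?neg = "\<lambda>x. - star_vec x :: 'a \<Rightarrow>\<^sub>0 real"
  have A: "level_sets (pair_vec x) = ({}, {fst x}, {snd x}, {})" if "x \<in> ?A" for x
    using that level_sets_pair_vec[of "fst x" "snd x"] by (auto simp: adjacent_or_linked_pairs_def)
  have B: "level_sets (star_vec x) = ({fst x}, {}, snd x, {}) \<and>
      level_sets (?neg x) = ({}, snd x, {}, {fst x}) \<and> card (snd x) = 2" if "x \<in> ?B" for x
    using that level_sets_star_vec[of "snd x" "fst x"]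
    by (auto simp: two_stars_def card_ge_0_finite subset_Diff_insert)
  have C: "level_sets (matching_vec x) = ({}, fst x, snd x, {}) \<and> card (fst x) = 2" if "x \<in> ?C" for x
    using that level_sets_matching_vec[of "fst x" "snd x"]
    by (auto simp: matched_pairs_def card_ge_0_finite)
  have fin: "finite ?A" "finite ?B" "finite ?C"
    using V by (auto intro: finite_subset[of _ "V \<times> V"] finite_subset[of _ "V \<times> Pow V"]
        finite_subset[of _ "Pow V \<times> Pow V"] simp: adjacent_or_linked_pairs_def two_stars_def matched_pairs_def)
  have inj: "inj_on pair_vec ?A" "inj_on star_vec ?B" "inj_on ?neg ?B" "inj_on matching_vec ?C"
    using A B C by (auto intro!: inj_onI prod_eqI dest!: arg_cong[of _ _ level_sets])
  \<comment> \<open>The kinds differ in which level sets are empty, except for pairs and matchings,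
    which are told apart by the size of the level set of 1.\<close>
  have ls: "y \<in> pair_vec ` ?A \<Longrightarrow> \<exists>i j. level_sets y = ({}, {i}, {j}, {})"
    "y \<in> star_vec ` ?B \<Longrightarrow> \<exists>i B. level_sets y = ({i}, {}, B, {})"
    "y \<in> ?neg ` ?B \<Longrightarrow> \<exists>i B. level_sets y = ({}, B, {}, {i})"
    "y \<in> matching_vec ` ?C \<Longrightarrow> \<exists>B C. level_sets y = ({}, B, C, {}) \<and> card B = 2" for y
    using A B C by blast+
  have disj: "pair_vec ` ?A \<inter> star_vec ` ?B = {}" "(pair_vec ` ?A \<union> star_vec ` ?B) \<inter> ?neg ` ?B = {}"
    "(pair_vec ` ?A \<union> star_vec ` ?B \<union> ?neg ` ?B) \<inter> matching_vec ` ?C = {}"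
    by (fastforce dest!: ls)+
  have "card (pair_vec ` ?A \<union> star_vec ` ?B \<union> ?neg ` ?B \<union> matching_vec ` ?C)
      = card ?A + 2 * card ?B + card ?C"
    using fin inj disj by (simp add: card_Un_disjoint card_image)
  with arg_cong[where f = card, OF sums_of_edge_vectors[OF assms]] show ?thesis
    by (rule trans)
qed

subsection \<open>Expectations over the random graph\<close>

lemma finite_complete_arcs: "finite (complete_arcs n)"
  by (rule finite_subset[of _ "Pow {1..n}"]) (auto simp: complete_arcs_def)

lemma set_pmf_erdos_renyi: "set_pmf (erdos_renyi n p) \<subseteq> Pow (complete_arcs n)"
  by (auto simp: erdos_renyi_def)

lemma integrable_erdos_renyi:
  "integrable (measure_pmf (erdos_renyi n p)) (f :: nat set set \<Rightarrow> real)"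
  using finite_subset[OF set_pmf_erdos_renyi] finite_complete_arcs
  by (intro integrable_measure_pmf_finite) auto

lemma prod_of_bool:
  "finite F \<Longrightarrow> (\<Prod>e\<in>F. of_bool (P e)) = (of_bool (\<forall>e\<in>F. P e) :: 'a::comm_semiring_1)"
  by (induction F rule: finite_induct) auto

text \<open>Arcs are independent. Padding the product with factors 1 outside \<open>F\<close> lets
  it range over all arcs, as the product formula for \<open>Pi_pmf\<close> requires.\<close>

lemma expectation_all_retained:
  assumes "F \<subseteq> complete_arcs n" "0 \<le> p" "p \<le> 1"
  shows "measure_pmf.expectation (erdos_renyi n p) (\<lambda>E. \<Prod>e\<in>F. of_bool (e \<in> E) :: real) = p ^ card F"
proof -
  let ?A = "complete_arcs n"
  have "measure_pmf.expectation (erdos_renyi n p) (\<lambda>E. \<Prod>e\<in>F. of_bool (e \<in> E))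
      = measure_pmf.expectation (Pi_pmf ?A False (\<lambda>_. bernoulli_pmf p))
          (\<lambda>r. \<Prod>e\<in>?A. if e \<in> F then of_bool (r e) else 1 :: real)"
  proof -
    have "(\<Prod>e\<in>F. of_bool (e \<in> {e \<in> ?A. r e})) = (\<Prod>e\<in>?A. if e \<in> F then of_bool (r e) else 1 :: real)"
      for r
    proof -
      have "(\<Prod>e\<in>?A. if e \<in> F then of_bool (r e) else 1 :: real) = (\<Prod>e\<in>F. of_bool (r e))"
        using assms(1) finite_complete_arcs by (simp add: prod.If_cases Int_absorb1)
      also have "\<dots> = (\<Prod>e\<in>F. of_bool (e \<in> {e \<in> ?A. r e}))"
        using assms(1) by (intro prod.cong) auto
      finally show ?thesis ..
    qed
    then show ?thesis by (simp only: erdos_renyi_def integral_map_pmf)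
  qed
  also have "\<dots> = (\<Prod>e\<in>?A. measure_pmf.expectation (bernoulli_pmf p) (\<lambda>b. if e \<in> F then of_bool b else 1))"
    using expectation_prod_Pi_pmf[where A = ?A and p = "\<lambda>_. bernoulli_pmf p" and dflt = False
        and f = "\<lambda>e b. if e \<in> F then of_bool b else 1"]
    by (simp add: finite_complete_arcs integrable_measure_pmf_finite)
  also have "\<dots> = (\<Prod>e\<in>?A. if e \<in> F then p else 1)"
    using assms(2,3) by (intro prod.cong) auto
  also have "\<dots> = p ^ card F"
    using assms(1) finite_complete_arcs by (simp add: prod.If_cases Int_absorb1)
  finally show ?thesis .
qed

lemma doubleton_in_complete_arcs_iff:
  "{i, j} \<in> complete_arcs n \<longleftrightarrow> i \<in> {1..n} \<and> j \<in> {1..n} \<and> i \<noteq> j"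
  by (auto simp: complete_arcs_def card_2_iff doubleton_eq_iff)

lemma expectation_star:
  assumes "i \<in> {1..n}" "B \<subseteq> {1..n} - {i}" "0 \<le> p" "p \<le> 1"
  shows "measure_pmf.expectation (erdos_renyi n p) (\<lambda>E. of_bool (\<forall>j\<in>B. {i, j} \<in> E)) = p ^ card B"
proof -
  have inj: "inj_on (\<lambda>j. {i, j}) B"
    by (auto simp: inj_on_def doubleton_eq_iff)
  have fin: "finite B" using assms(2) finite_subset by blast
  have "of_bool (\<forall>j\<in>B. {i, j} \<in> E) = (\<Prod>e\<in>(\<lambda>j. {i, j}) ` B. of_bool (e \<in> E) :: real)" for E
    using fin by (simp add: prod_of_bool del: prod.insert)
  moreover have "(\<lambda>j. {i, j}) ` B \<subseteq> complete_arcs n"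
    using assms(1,2) by (auto simp: doubleton_in_complete_arcs_iff)
  ultimately show ?thesis
    using assms(3,4) by (simp only: expectation_all_retained card_image[OF inj])
qed

text \<open>Inclusion-exclusion over the two matchings, which together use four distinct arcs: 2p^2
  - p^4.\<close>

lemma expectation_two_matchings:
  assumes ijkl: "{i, j, k, l} \<subseteq> {1..n}" "distinct [i, j, k, l]" and p: "0 \<le> p" "p \<le> 1"
  shows "measure_pmf.expectation (erdos_renyi n p)
      (\<lambda>E. of_bool ({i, k} \<in> E \<and> {j, l} \<in> E \<or> {i, l} \<in> E \<and> {j, k} \<in> E)) = p^2 * (2 - p^2)"
proof -
  let ?X = "\<lambda>F E. (\<Prod>e\<in>F. of_bool (e \<in> E)) :: real"
  let ?F = "{{i, k}, {j, l}}" and ?G = "{{i, l}, {j, k}}"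
  have sub: "?F \<subseteq> complete_arcs n" "?G \<subseteq> complete_arcs n"
    using ijkl by (auto simp: doubleton_in_complete_arcs_iff)
  have card: "card ?F = 2" "card ?G = 2" "card (?F \<union> ?G) = 4"
    using ijkl(2) by (auto simp: doubleton_eq_iff card_insert_if)
  have "of_bool ({i, k} \<in> E \<and> {j, l} \<in> E \<or> {i, l} \<in> E \<and> {j, k} \<in> E)
      = ?X ?F E + ?X ?G E - ?X (?F \<union> ?G) E" for E
    using ijkl(2) by (auto simp: doubleton_eq_iff)
  then have "measure_pmf.expectation (erdos_renyi n p)
      (\<lambda>E. of_bool ({i, k} \<in> E \<and> {j, l} \<in> E \<or> {i, l} \<in> E \<and> {j, k} \<in> E)) =
      measure_pmf.expectation (erdos_renyi n p) (\<lambda>E. ?X ?F E + ?X ?G E - ?X (?F \<union> ?G) E)"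
    by simp
  also have "\<dots> = measure_pmf.expectation (erdos_renyi n p) (?X ?F)
      + measure_pmf.expectation (erdos_renyi n p) (?X ?G)
      - measure_pmf.expectation (erdos_renyi n p) (?X (?F \<union> ?G))"
    by (simp only: Bochner_Integration.integral_add Bochner_Integration.integral_diff integrable_erdos_renyi)
  also have "\<dots> = p^2 + p^2 - p^4"
    using sub by (simp only: expectation_all_retained p card Un_least)
  finally show ?thesis
    by (simp add: algebra_simps power_numeral_reduce)
qed

text \<open>
  Expands \<open>(1 - X\<^sub>i\<^sub>j) \<Prod>\<^sub>k (1 - X\<^sub>i\<^sub>k X\<^sub>k\<^sub>j)\<close>, with \<open>X\<close> the arc indicators, into products over distinct arcs,
  on which the expectation is multiplicative.
\<close>

lemma expectation_adjacent_or_common_neighbour: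
  assumes ij: "i \<in> {1..n}" "j \<in> {1..n}" "i \<noteq> j" and p: "0 \<le> p" "p \<le> 1"
  shows "measure_pmf.expectation (erdos_renyi n p)
      (\<lambda>E. of_bool ({i, j} \<in> E \<or> (\<exists>k\<in>{1..n} - {i, j}. {i, k} \<in> E \<and> {k, j} \<in> E)))
    = p + (1 - p) * (1 - (1 - p^2) ^ (n - 2))"
proof -
  define K where "K = {1..n} - {i, j}"
  have finK: "finite K" by (simp add: K_def)
  \<comment> \<open>Two distinct nodes exist, so \<open>n - 2\<close> is not truncated.\<close>
  have cardK: "card K = n - 2"
    using ij by (simp add: K_def card_Diff_subset)
  let ?E = "\<lambda>f. measure_pmf.expectation (erdos_renyi n p) f"
  let ?X = "\<lambda>F E. (\<Prod>e\<in>F. of_bool (e \<in> E)) :: real"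
  \<comment> \<open>The arcs of the paths \<open>i\<close>, \<open>k\<close>, \<open>j\<close> with
    \<open>k\<close> in \<open>J\<close>; there are \<open>2 * card J\<close> of them and none is
    \<open>{i, j}\<close>.\<close>
  define G where "G J = (\<Union>k\<in>J. {{i, k}, {k, j}})" for J
  have X_G: "(\<Prod>k\<in>J. of_bool ({i, k} \<in> E) * of_bool ({k, j} \<in> E)) = ?X (G J) E"
    if "J \<subseteq> K" for J E
  proof -
    have "finite J" using that finK finite_subset by blast
    moreover from this have "finite (G J)" by (simp add: G_def)
    ultimately show ?thesis
      by (simp only: prod_of_bool flip: of_bool_conj) (auto simp: G_def)
  qed
  have card_G: "card (G J) = 2 * card J" if "J \<subseteq> K" for J
  proof -
    have "finite J" using that finK finite_subset by blast
    moreover have "card {{i, k}, {k, j}} = 2" for k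
      using ij by (auto simp: card_2_iff doubleton_eq_iff)
    ultimately show ?thesis
      unfolding G_def using that ij
      by (subst card_UN_disjoint) (auto simp: K_def doubleton_eq_iff subset_iff)
  qed
  have G_sub: "G J \<subseteq> complete_arcs n" if "J \<subseteq> K" for J
    using that ij by (auto simp: G_def K_def doubleton_in_complete_arcs_iff)
  have ij_notin: "{i, j} \<notin> G J" if "J \<subseteq> K" for J
    using that ij by (auto simp: G_def K_def doubleton_eq_iff)
  have ij_arc: "{i, j} \<in> complete_arcs n"
    using ij by (simp add: doubleton_in_complete_arcs_iff)
  have expand: "of_bool ({i, j} \<in> E \<or> (\<exists>k\<in>K. {i, k} \<in> E \<and> {k, j} \<in> E))
      = 1 - (\<Sum>J\<in>Pow K. (-1) ^ card J * (?X (G J) E - ?X (insert {i, j} (G J)) E))" for E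
  proof -
    \<comment> \<open>The factors are written \<open>- a + 1\<close> to fit \<open>prod_add\<close>,
      which expands the product over the subsets of \<open>K\<close>.\<close>
    have "of_bool ({i, j} \<in> E \<or> (\<exists>k\<in>K. {i, k} \<in> E \<and> {k, j} \<in> E))
        = 1 - (1 - of_bool ({i, j} \<in> E)) *
            (\<Prod>k\<in>K. - (of_bool ({i, k} \<in> E) * of_bool ({k, j} \<in> E)) + 1 :: real)"
    proof -
      have "(\<Prod>k\<in>K. - (of_bool ({i, k} \<in> E) * of_bool ({k, j} \<in> E)) + 1 :: real)
          = (\<Prod>k\<in>K. of_bool (\<not> ({i, k} \<in> E \<and> {k, j} \<in> E)))"
        by (intro prod.cong refl) simp
      then show ?thesis
        by (simp add: prod_of_bool[OF finK] del: of_bool_not_iff)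
    qed
    also have "(\<Prod>k\<in>K. - (of_bool ({i, k} \<in> E) * of_bool ({k, j} \<in> E)) + 1 :: real)
        = (\<Sum>J\<in>Pow K. (\<Prod>k\<in>J. - (of_bool ({i, k} \<in> E) * of_bool ({k, j} \<in> E))) * (\<Prod>k\<in>K - J. 1))"
      by (rule prod_add[OF finK])
    also have "\<dots> = (\<Sum>J\<in>Pow K. (-1) ^ card J * ?X (G J) E)"
      by (intro sum.cong refl) (simp add: prod_uminus X_G)
    also have "(1 - of_bool ({i, j} \<in> E)) * \<dots>
        = (\<Sum>J\<in>Pow K. (-1) ^ card J * (?X (G J) E - ?X (insert {i, j} (G J)) E))"
      unfolding sum_distrib_left
    proof (intro sum.cong refl)
      fix J assume J: "J \<in> Pow K"
      have "finite (G J)"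
        using G_sub[of J] J finite_complete_arcs finite_subset by blast
      then have "?X (insert {i, j} (G J)) E = of_bool ({i, j} \<in> E) * ?X (G J) E"
        using ij_notin[of J] J by simp
      then show "(1 - of_bool ({i, j} \<in> E)) * ((-1) ^ card J * ?X (G J) E)
          = (-1) ^ card J * (?X (G J) E - ?X (insert {i, j} (G J)) E)"
        by (simp add: algebra_simps)
    qed
    finally show ?thesis .
  qed
  have single: "?E (\<lambda>E. ?X (G J) E - ?X (insert {i, j} (G J)) E) = (p^2) ^ card J * (1 - p)"
    if J: "J \<subseteq> K" for J
  proof -
    have "finite (G J)"
      using G_sub[of J] J finite_complete_arcs finite_subset by blast
    then have "card (insert {i, j} (G J)) = Suc (2 * card J)"
      using ij_notin[OF J] card_G[OF J] by simp
    moreover have "insert {i, j} (G J) \<subseteq> complete_arcs n"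
      using G_sub[OF J] ij_arc by simp
    ultimately have "?E (?X (insert {i, j} (G J))) = p ^ Suc (2 * card J)"
      using expectation_all_retained[OF _ p] by metis
    moreover have "?E (?X (G J)) = p ^ (2 * card J)"
      using expectation_all_retained[OF G_sub[OF J] p] card_G[OF J] by simp
    moreover have "?E (\<lambda>E. ?X (G J) E - ?X (insert {i, j} (G J)) E)
        = ?E (?X (G J)) - ?E (?X (insert {i, j} (G J)))"
      by (simp only: Bochner_Integration.integral_diff integrable_erdos_renyi)
    ultimately show ?thesis
      by (simp only: power_mult[symmetric] power_Suc right_diff_distrib mult_1_right mult.commute[of p])
  qed
  have "?E (\<lambda>E. of_bool ({i, j} \<in> E \<or> (\<exists>k\<in>K. {i, k} \<in> E \<and> {k, j} \<in> E)))
      = 1 - (\<Sum>J\<in>Pow K. (-1) ^ card J * ?E (\<lambda>E. ?X (G J) E - ?X (insert {i, j} (G J)) E))"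
    unfolding expand
    by (simp only: Bochner_Integration.integral_diff Bochner_Integration.integral_sum
        Bochner_Integration.integral_mult_right_zero integrable_erdos_renyi) simp
  \<comment> \<open>After taking expectations the same subset expansion is run backwards, with
    \<open>p^2\<close> in place of the random factors.\<close>
  also have "(\<Sum>J\<in>Pow K. (-1) ^ card J * ?E (\<lambda>E. ?X (G J) E - ?X (insert {i, j} (G J)) E))
      = (\<Sum>J\<in>Pow K. (\<Prod>k\<in>J. - (p^2)) * (\<Prod>k\<in>K - J. 1) * (1 - p))"
    by (intro sum.cong refl) (simp add: single power_minus[of "p^2"])
  also have "\<dots> = (\<Sum>J\<in>Pow K. (\<Prod>k\<in>J. - (p^2)) * (\<Prod>k\<in>K - J. 1)) * (1 - p)"
    by (simp only: sum_distrib_right)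
  also have "(\<Sum>J\<in>Pow K. (\<Prod>k\<in>J. - (p^2)) * (\<Prod>k\<in>K - J. 1)) = (\<Prod>k\<in>K. - (p^2) + 1)"
    by (rule prod_add[OF finK, symmetric])
  also have "\<dots> = (1 - p^2) ^ (n - 2)"
    by (simp add: cardK)
  finally show ?thesis
    by (simp add: K_def algebra_simps)
qed

section \<open>Expected number of vectors of each kind\<close>

lemma expectation_card_filter:
  assumes "finite I"
  shows "measure_pmf.expectation (erdos_renyi n p) (\<lambda>E. real (card {x \<in> I. Q x E}))
    = (\<Sum>x\<in>I. measure_pmf.expectation (erdos_renyi n p) (\<lambda>E. of_bool (Q x E)))"
proof -
  have "real (card {x \<in> I. Q x E}) = (\<Sum>x\<in>I. of_bool (Q x E))" for E
    using assms by (simp add: Int_def)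
  then show ?thesis
    by (simp only: Bochner_Integration.integral_sum integrable_erdos_renyi)
qed

lemma expectation_card_adjacent_or_linked_pairs:
  assumes p: "0 \<le> p" "p \<le> 1"
  shows "measure_pmf.expectation (erdos_renyi n p) (\<lambda>E. real (card (adjacent_or_linked_pairs {1..n} E)))
    = 2 * real (n choose 2) * (p + (1 - p) * (1 - (1 - p^2) ^ (n - 2)))"
proof -
  define I where "I = (SIGMA i:{1..n}. {1..n} - {i})"
  have "adjacent_or_linked_pairs {1..n} E = {x \<in> I. {fst x, snd x} \<in> E \<or>
      (\<exists>k\<in>{1..n} - {fst x, snd x}. {fst x, k} \<in> E \<and> {k, snd x} \<in> E)}" for E
    by (auto simp: adjacent_or_linked_pairs_def I_def)
  moreover have "finite I" by (simp add: I_def)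
  ultimately have "measure_pmf.expectation (erdos_renyi n p)
        (\<lambda>E. real (card (adjacent_or_linked_pairs {1..n} E)))
      = (\<Sum>x\<in>I. p + (1 - p) * (1 - (1 - p^2) ^ (n - 2)))"
    using p by (simp only: expectation_card_filter, intro sum.cong refl)
      (rule expectation_adjacent_or_common_neighbour, auto simp: I_def)
  moreover have "card I = n * (n - 1)"
    by (simp add: I_def card_SigmaI)
  moreover have "n * (n - 1) = 2 * (n choose 2)"
    using times_binomial_minus1_eq[of 2 n] by simp
  ultimately show ?thesis
    by (simp flip: of_nat_mult)
qed

lemma expectation_card_two_stars:
  assumes p: "0 \<le> p" "p \<le> 1"
  shows "measure_pmf.expectation (erdos_renyi n p) (\<lambda>E. real (card (two_stars {1..n} E)))
    = 3 * real (n choose 3) * p^2"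
proof -
  define I where "I = (SIGMA i:{1..n}. {B. B \<subseteq> {1..n} - {i} \<and> card B = 2})"
  have "two_stars {1..n} E = {x \<in> I. \<forall>j\<in>snd x. {fst x, j} \<in> E}" for E
    by (auto simp: two_stars_def I_def)
  moreover have "finite I" by (simp add: I_def)
  ultimately have "measure_pmf.expectation (erdos_renyi n p) (\<lambda>E. real (card (two_stars {1..n} E)))
      = (\<Sum>x\<in>I. measure_pmf.expectation (erdos_renyi n p) (\<lambda>E. of_bool (\<forall>j\<in>snd x. {fst x, j} \<in> E)))"
    by (simp only: expectation_card_filter)
  also have "\<dots> = (\<Sum>x\<in>I. p^2)"
  proof (intro sum.cong refl)
    fix x assume "x \<in> I"
    then have "fst x \<in> {1..n}" "snd x \<subseteq> {1..n} - {fst x}" "card (snd x) = 2"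
      by (auto simp: I_def)
    then show "measure_pmf.expectation (erdos_renyi n p) (\<lambda>E. of_bool (\<forall>j\<in>snd x. {fst x, j} \<in> E)) = p^2"
      using expectation_star[of "fst x" n "snd x", OF _ _ p] by simp
  qed
  also have "\<dots> = real (n * ((n - 1) choose 2)) * p^2"
    by (simp add: I_def card_SigmaI n_subsets)
  \<comment> \<open>A star is a 3-subset with one of its three elements chosen as centre.\<close>
  also have "n * ((n - 1) choose 2) = 3 * (n choose 3)"
    using times_binomial_minus1_eq[of 3 n] by simp
  finally show ?thesis by simp
qed

lemma expectation_card_matched_pairs:
  assumes p: "0 \<le> p" "p \<le> 1"
  shows "measure_pmf.expectation (erdos_renyi n p) (\<lambda>E. real (card (matched_pairs {1..n} E)))
    = 6 * real (n choose 4) * (p^2 * (2 - p^2))"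
proof -
  define I where "I = (SIGMA B:{B. B \<subseteq> {1..n} \<and> card B = 2}. {C. C \<subseteq> {1..n} - B \<and> card C = 2})"
  define Q :: "nat set \<times> nat set \<Rightarrow> nat set set \<Rightarrow> bool" where
    "Q x E \<longleftrightarrow> (\<exists>i j k l. fst x = {i, j} \<and> snd x = {k, l} \<and> {i, k} \<in> E \<and> {j, l} \<in> E)" for x E
  have "matched_pairs {1..n} E = {x \<in> I. Q x E}" for E
  proof (rule set_eqI)
    fix x :: "nat set \<times> nat set"
    show "x \<in> matched_pairs {1..n} E \<longleftrightarrow> x \<in> {x \<in> I. Q x E}"
      by (cases x) (simp only: matched_pairs_def I_def Q_def mem_Collect_eq case_prod_conv
          mem_Sigma_iff fst_conv snd_conv, blast)
  qed
  moreover have "finite I"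
    unfolding I_def by (intro finite_SigmaI) auto
  ultimately have "measure_pmf.expectation (erdos_renyi n p) (\<lambda>E. real (card (matched_pairs {1..n} E)))
      = (\<Sum>x\<in>I. measure_pmf.expectation (erdos_renyi n p) (\<lambda>E. of_bool (Q x E)))"
    by (simp only: expectation_card_filter)
  also have "\<dots> = (\<Sum>x\<in>I. p^2 * (2 - p^2))"
  proof (intro sum.cong refl)
    fix x assume x: "x \<in> I"
    then obtain i j k l where ijkl: "fst x = {i, j}" "i \<noteq> j" "snd x = {k, l}" "k \<noteq> l"
      by (auto simp: I_def card_2_iff)
    have "{i, j, k, l} \<subseteq> {1..n}" "distinct [i, j, k, l]"
      using x ijkl by (auto simp: I_def)
    note * = expectation_two_matchings[OF this p]
    \<comment> \<open>Up to swapping names, the labellings of the two pairs give just two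
      matchings.\<close>
    have "Q x E \<longleftrightarrow> {i, k} \<in> E \<and> {j, l} \<in> E \<or> {i, l} \<in> E \<and> {j, k} \<in> E" for E
    proof
      assume "Q x E"
      then obtain i' j' k' l' where "{i, j} = {i', j'}" "{k, l} = {k', l'}" "{i', k'} \<in> E" "{j', l'} \<in> E"
        using ijkl by (auto simp: Q_def)
      then show "{i, k} \<in> E \<and> {j, l} \<in> E \<or> {i, l} \<in> E \<and> {j, k} \<in> E"
        by (auto simp: doubleton_eq_iff)
    next
      assume "{i, k} \<in> E \<and> {j, l} \<in> E \<or> {i, l} \<in> E \<and> {j, k} \<in> E"
      moreover have "{k, l} = {l, k}" by auto
      ultimately show "Q x E"
        unfolding Q_def ijkl by blast
    qed
    then show "measure_pmf.expectation (erdos_renyi n p) (\<lambda>E. of_bool (Q x E)) = p^2 * (2 - p^2)"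
      using * by simp
  qed
  also have "\<dots> = real (card I) * (p^2 * (2 - p^2))" by simp
  also have "card I = (\<Sum>B | B \<subseteq> {1..n} \<and> card B = 2. card {C. C \<subseteq> {1..n} - B \<and> card C = 2})"
    unfolding I_def by (rule card_SigmaI) auto
  also have "\<dots> = (\<Sum>B | B \<subseteq> {1..n} \<and> card B = 2. (n - 2) choose 2)"
    by (intro sum.cong refl) (auto simp: n_subsets card_Diff_subset finite_subset)
  also have "\<dots> = (n choose 2) * ((n - 2) choose 2)"
    by (simp add: n_subsets)
  \<comment> \<open>A 4-subset splits into an ordered pair of 2-subsets in six ways.\<close>
  also have "\<dots> = 6 * (n choose 4)"
  proof -
    have a: "2 * (n choose 2) = n * (n - 1)"
      using times_binomial_minus1_eq[of 2 n] by simp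
    have b: "3 * ((n - 1) choose 3) = (n - 1) * ((n - 2) choose 2)"
      using times_binomial_minus1_eq[of 3 "n - 1"] by (simp flip: numeral_2_eq_2)
    have c: "4 * (n choose 4) = n * ((n - 1) choose 3)"
      using times_binomial_minus1_eq[of 4 n] by simp
    have "12 * (n choose 4) = 3 * (4 * (n choose 4))" by simp
    also have "\<dots> = n * (3 * ((n - 1) choose 3))" unfolding c by simp
    also have "\<dots> = (n * (n - 1)) * ((n - 2) choose 2)" unfolding b by simp
    finally show ?thesis unfolding a[symmetric] by simp
  qed
  finally show ?thesis by simp
qed

subsection \<open>Asymptotics\<close>

lemma one_minus_power_le:
  fixes x :: real
  assumes "0 \<le> x" "x \<le> 1"
  shows "1 - (1 - x) ^ m \<le> real m * x"
  using Bernoulli_inequality[of "- x" m] assms by simp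

text \<open>For \<open>n\<close> at least 6 the factors \<open>n - 1\<close>, \<open>n - 2\<close>,
  \<open>n - 3\<close> are at least \<open>n/2\<close>, whence the constant 192 = 24 * 8.\<close>

lemma binomial_four_ge:
  assumes "n \<ge> 6"
  shows "real n ^ 4 \<le> 192 * real (n choose 4)"
proof -
  have "24 * (n choose 4) = n * ((n - 1) * ((n - 2) * (n - 3)))"
  proof -
    have a: "4 * (n choose 4) = n * ((n - 1) choose 3)"
      using times_binomial_minus1_eq[of 4 n] by simp
    have b: "3 * ((n - 1) choose 3) = (n - 1) * ((n - 2) choose 2)"
      using times_binomial_minus1_eq[of 3 "n - 1"] by (simp flip: numeral_2_eq_2)
    have c: "2 * ((n - 2) choose 2) = (n - 2) * (n - 3)"
      using times_binomial_minus1_eq[of 2 "n - 2"] by simp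
    have "24 * (n choose 4) = 6 * (4 * (n choose 4))" by simp
    also have "\<dots> = 2 * (n * (3 * ((n - 1) choose 3)))" unfolding a by simp
    also have "\<dots> = n * ((n - 1) * (2 * ((n - 2) choose 2)))" unfolding b by simp
    finally show ?thesis unfolding c .
  qed
  from arg_cong[where f = real, OF this]
  have "24 * real (n choose 4) = real n * (real (n - 1) * (real (n - 2) * real (n - 3)))"
    by (simp only: of_nat_mult of_nat_numeral)
  moreover have "real n * (real n / 2 * (real n / 2 * (real n / 2)))
      \<le> real n * (real (n - 1) * (real (n - 2) * real (n - 3)))"
    using assms by (intro mult_left_mono mult_mono) auto
  ultimately show ?thesis
    by (simp add: power_numeral_reduce)
qed

definition edge_formula :: "nat \<Rightarrow> real \<Rightarrow> real" where
  "edge_formula n p = 6 * real (n choose 4) * p^2 * (2 - p^2) + 6 * real (n choose 3) * p^2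
     + 2 * real (n choose 2) * (1 - p) * (1 - (1 - p^2) ^ (n - 2)) + 2 * real (n choose 2) * p"

text \<open>From below the quartic term alone suffices. From above the terms contribute 12, 6, 2 and
  \<open>2 / c\<close> times \<open>n^4 p^2\<close>; only the last, linear in \<open>p\<close>, uses
  the lower bound \<open>c\<close> on \<open>n^2 p\<close>.\<close>

lemma edge_formula_bounds:
  assumes p: "0 < p" "p < 1" and "n \<ge> 6" and c: "c > 0" "c \<le> real n ^ 2 * p"
  shows "real n ^ 4 * p^2 / 32 \<le> edge_formula n p"
    and "edge_formula n p \<le> (20 + 2 / c) * (real n ^ 4 * p^2)"
proof -
  have p2: "0 \<le> p^2" "p^2 \<le> 1" using p by (auto simp: power_le_one)
  have pow: "0 \<le> 1 - (1 - p^2) ^ (n - 2)" using p2 by (simp add: power_le_one)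
  have le: "real (n choose k) \<le> real n ^ k" if "k \<le> n" for k
    using binomial_le_pow[OF that] by (simp flip: of_nat_power)
  \<comment> \<open>Here 1/32 = 6/192, and the factor \<open>2 - p^2\<close> is at least 1.\<close>
  have "real n ^ 4 * p^2 / 32 \<le> 6 * real (n choose 4) * p^2 * 1"
    using mult_right_mono[OF binomial_four_ge[OF \<open>n \<ge> 6\<close>] p2(1)] by simp
  also have "\<dots> \<le> 6 * real (n choose 4) * p^2 * (2 - p^2)"
    using p2 by (intro mult_left_mono) auto
  also have "\<dots> \<le> edge_formula n p"
    using p p2 pow by (simp add: edge_formula_def)
  finally show "real n ^ 4 * p^2 / 32 \<le> edge_formula n p" .
  define N where "N = real n ^ 4 * p^2"
  have mono: "real n ^ k \<le> real n ^ 4" if "k \<le> 4" for k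
    using that \<open>n \<ge> 6\<close> by (intro power_increasing) auto
  have "6 * real (n choose 4) * p^2 * (2 - p^2) \<le> 6 * real n ^ 4 * p^2 * 2"
    using p2 le[of 4] \<open>n \<ge> 6\<close> by (intro mult_mono) auto
  then have 1: "6 * real (n choose 4) * p^2 * (2 - p^2) \<le> 12 * N"
    by (simp add: N_def)
  have "6 * real (n choose 3) * p^2 \<le> 6 * real n ^ 4 * p^2"
    using p2 order_trans[OF le[of 3] mono[of 3]] \<open>n \<ge> 6\<close> by (intro mult_mono) auto
  then have 2: "6 * real (n choose 3) * p^2 \<le> 6 * N"
    by (simp add: N_def)
  have "1 - (1 - p^2) ^ (n - 2) \<le> real (n - 2) * p^2"
    by (rule one_minus_power_le[OF p2])
  also have "\<dots> \<le> real n * p^2"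
    using p2 by (intro mult_right_mono) auto
  finally have "2 * real (n choose 2) * (1 - p) * (1 - (1 - p^2) ^ (n - 2))
      \<le> 2 * real n ^ 2 * 1 * (real n * p^2)"
    using p pow le[of 2] \<open>n \<ge> 6\<close> by (intro mult_mono) auto
  also have "\<dots> = 2 * (real n ^ 3 * p^2)"
    by (simp add: power_numeral_reduce)
  also have "\<dots> \<le> 2 * N"
    unfolding N_def using p2 mono[of 3] by (intro mult_left_mono mult_right_mono) auto
  finally have 3: "2 * real (n choose 2) * (1 - p) * (1 - (1 - p^2) ^ (n - 2)) \<le> 2 * N" .
  have "2 * real (n choose 2) * p \<le> 2 * (real n ^ 2 * p)"
    using p le[of 2] \<open>n \<ge> 6\<close> by (simp add: mult_right_mono)
  \<comment> \<open>Multiplying by the factor \<open>n^2 p / c\<close>, which is at least 1, makes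
    the term quadratic in \<open>p\<close>.\<close>
  also have "\<dots> \<le> 2 * (real n ^ 2 * p) * ((real n ^ 2 * p) / c)"
    using c p mult_left_mono[of 1 "(real n ^ 2 * p) / c" "2 * (real n ^ 2 * p)"] by simp
  also have "\<dots> = 2 / c * N"
    by (simp add: N_def power_numeral_reduce)
  finally have 4: "2 * real (n choose 2) * p \<le> 2 / c * N" .
  from 1 2 3 4 show "edge_formula n p \<le> (20 + 2 / c) * (real n ^ 4 * p^2)"
    unfolding edge_formula_def N_def[symmetric] distrib_right by linarith
qed

text \<open>The asymptotic part assumes that \<open>n^2 p\<close> stays away from 0: if it tends to
  0, the term linear in \<open>p\<close>, of order \<open>n^2 p\<close>, outgrows
  \<open>n^4 p^2\<close> and the ratio is unbounded.\<close>

theorem theorem4p1: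
  fixes p :: "nat \<Rightarrow> real"
    and \<Delta> :: "nat \<Rightarrow> nat set set \<Rightarrow> (nat \<Rightarrow>\<^sub>0 real) set set"
  assumes "\<And>n. p n \<in> {0<..<1}"
    and "\<And>n E. E \<subseteq> complete_arcs n \<Longrightarrow>
           unimodular_triangulation (sep_lattice {1..n} E) (symmetric_edge_polytope E) (\<Delta> n E)"
  shows "(\<forall>n. expected_edges \<Delta> p n =
              6 * real (n choose 4) * (p n)^2 * (2 - (p n)^2)
            + 6 * real (n choose 3) * (p n)^2
            + 2 * real (n choose 2) * (1 - p n) * (1 - (1 - (p n)^2) ^ (n - 2))
            + 2 * real (n choose 2) * p n) \<and>
         (0 < liminf (\<lambda>n. ereal (real n ^ 2 * p n)) \<longrightarrow>
            same_order (expected_edges \<Delta> p) (\<lambda>n. real n ^ 4 * (p n)^2))"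
proof -
  have p: "0 < p n" "p n < 1" "0 \<le> p n" "p n \<le> 1" for n
    using assms(1)[of n] by auto
  have formula: "expected_edges \<Delta> p n = edge_formula n (p n)" for n
  proof -
    let ?G = "erdos_renyi n (p n)" and ?V = "{1..n}"
    \<comment> \<open>The count is needed only on the support of the random graph, where
      \<open>\<Delta> n E\<close> is known to be a unimodular triangulation.\<close>
    have "card (triangulation_edges (\<Delta> n E)) = card (adjacent_or_linked_pairs ?V E)
        + 2 * card (two_stars ?V E) + card (matched_pairs ?V E)" if "E \<in> set_pmf ?G" for E
    proof -
      have E: "E \<subseteq> complete_arcs n" using that set_pmf_erdos_renyi by blast
      then have arcs: "\<And>e. e \<in> E \<Longrightarrow> e \<subseteq> ?V \<and> card e = 2" by (auto simp: complete_arcs_def)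
      show ?thesis
        by (rule trans[OF card_triangulation_edges_sep card_sums_of_edge_vectors])
          (use arcs assms(2)[OF E] in auto)
    qed
    then have "expected_edges \<Delta> p n = measure_pmf.expectation ?G
        (\<lambda>E. real (card (adjacent_or_linked_pairs ?V E)) + 2 * real (card (two_stars ?V E))
          + real (card (matched_pairs ?V E)))"
      unfolding expected_edges_def
      by (intro Bochner_Integration.integral_cong_AE AE_pmfI) auto
    also have "\<dots> = measure_pmf.expectation ?G (\<lambda>E. real (card (adjacent_or_linked_pairs ?V E)))
        + 2 * measure_pmf.expectation ?G (\<lambda>E. real (card (two_stars ?V E)))
        + measure_pmf.expectation ?G (\<lambda>E. real (card (matched_pairs ?V E)))"
      by (simp only: Bochner_Integration.integral_add Bochner_Integration.integral_mult_right_zero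
          integrable_erdos_renyi)
    also have "\<dots> = edge_formula n (p n)"
      using p by (simp only: expectation_card_adjacent_or_linked_pairs expectation_card_two_stars
          expectation_card_matched_pairs edge_formula_def) (simp add: algebra_simps)
    finally show ?thesis .
  qed
  have "same_order (expected_edges \<Delta> p) (\<lambda>n. real n ^ 4 * (p n)^2)"
    if liminf: "0 < liminf (\<lambda>n. ereal (real n ^ 2 * p n))"
  proof -
    \<comment> \<open>Any real \<open>c\<close> strictly between 0 and the liminf is eventually a
      lower bound for \<open>n^2 p\<close>.\<close>
    obtain c :: real where c: "0 < ereal c" "ereal c < liminf (\<lambda>n. ereal (real n ^ 2 * p n))"
      using ereal_dense2[OF liminf] by auto
    have ev: "eventually (\<lambda>n. ereal c < ereal (real n ^ 2 * p n) \<and> n \<ge> 6) sequentially"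
      using less_LiminfD[OF c(2)] eventually_ge_at_top[of 6] by (rule eventually_conj)
    let ?q = "\<lambda>n. ereal \<bar>expected_edges \<Delta> p n / (real n ^ 4 * (p n)^2)\<bar>"
    have bounds: "1 / 32 \<le> \<bar>expected_edges \<Delta> p n / (real n ^ 4 * (p n)^2)\<bar> \<and>
        \<bar>expected_edges \<Delta> p n / (real n ^ 4 * (p n)^2)\<bar> \<le> 20 + 2 / c"
      if n: "ereal c < ereal (real n ^ 2 * p n) \<and> n \<ge> 6" for n
    proof -
      have pos: "0 < real n ^ 4 * (p n)^2" using n p[of n] by simp
      have "real n ^ 4 * (p n)^2 / 32 \<le> edge_formula n (p n)"
        "edge_formula n (p n) \<le> (20 + 2 / c) * (real n ^ 4 * (p n)^2)"
        using edge_formula_bounds[OF p(1)[of n] p(2)[of n], of n c] n c by simp_all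
      moreover from this have "0 \<le> edge_formula n (p n)" using pos by simp
      ultimately show ?thesis
        using pos by (simp add: formula divide_simps)
    qed
    have lower: "ereal (1 / 32) \<le> liminf ?q"
      by (rule Liminf_bounded) (rule eventually_mono[OF ev], use bounds in simp)
    have upper: "limsup ?q \<le> ereal (20 + 2 / c)"
      by (rule Limsup_bounded) (rule eventually_mono[OF ev], use bounds in simp)
    show ?thesis
      unfolding same_order_def
    proof (intro conjI)
      show "0 < liminf ?q"
        by (rule less_le_trans[OF _ lower]) simp
      show "liminf ?q \<le> limsup ?q"
        by (rule Liminf_le_Limsup) simp
      show "limsup ?q < \<infinity>"
        by (rule le_less_trans[OF upper]) simp
    qed
  qed
  then show ?thesis
    using formula by (simp add: edge_formula_def)
qed

end
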